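(* Let $H_0$ be a self-adjoint operator on a separable Hilbert space $\mathcal H$, diagonal in an orthonormal basis $\mathbf e=(e_k)_{k\in J}$, $J\subseteq\mathbb N$, with eigenvalues $E_0(k)$ (not assumed simple). Let $B\in\mathcal L^{\mathbb R}=\mathcal L^{\mathbb R}_{\mathbf e}[[\mu]]$ be of order $\ge1$ in $\mu$ and finite-band, with homogeneous components $B_\lambda$, $\lambda\in\mathcal N$. For each word $\underline\lambda\in\underline{\mathcal N}$ define $$N^{\underline\lambda}=-\,\text{residue of }U_-^{\underline\lambda}(\varepsilon),\qquad S^{\underline\lambda}=\text{constant term of }U_+^{\underline\lambda}(\varepsilon),$$ where $(U_-,U_+)$ is the Birkhoff decomposition of the $\mathbb C((\varepsilon))$-valued mould $$T^{\lambda_1\cdots\lambda_r}(\varepsilon)=\frac1{(\lambda_1+\varepsilon)(\lambda_1+\lambda_2+2\varepsilon)\cdots(\lambda_1+\cdots+\lambda_r+r\varepsilon)} .$$ Then the formulae $$N=\sum_{\underline\lambda\in\underline{\mathcal N}}N^{\underline\lambda}\ \tfrac1{i\hbar}\big[B_{\lambda_1},\tfrac1{i\hbar}[B_{\lambda_2},\dots\tfrac1{i\hbar}[B_{\lambda_{r(\underline\lambda)-1}},B_{\lambda_{r(\underline\lambda)}}]\dots]\big],$$ $$\Psi(\cdot)=\sum_{\underline\lambda\in\underline{\mathcal N}}S^{\underline\lambda}\ \tfrac1{i\hbar}\big[B_{\lambda_1},\tfrac1{i\hbar}[B_{\lambda_2},\dots\tfrac1{i\hbar}[B_{\lambda_{r(\underline\lambda)}},\,\cdot\,]\dots]\big]$$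 define respectively an element of $\mathcal L^{\mathbb R}$ and a unitary conjugation satisfying $$\Psi(H_0+B)=H_0+N\quad\text{and}\quad[H_0,N]=0 .$$ Moreover $\Psi(A)=CAC^{-1}$ with a unitary $C$ given by $$C=\sum_{\underline\lambda\in\underline{\mathcal N}}\big(\tfrac1{i\hbar}\big)^{r(\underline\lambda)}S^{\underline\lambda}\,B_{\lambda_1}B_{\lambda_2}\cdots B_{\lambda_{r(\underline\lambda)}} .$$
   Context: $\hbar>0$ is fixed, $\mu$ is a formal (real) parameter, inner products are linear in the second argument, and $[\cdot,\cdot]$ denotes commutators. $\mathcal L^{\mathbb C}_{\mathbf e}$ is the associative algebra of linear operators with domain $\mathrm{Span}_{\mathbb C}(\mathbf e)$ which preserve $\mathrm{Span}_{\mathbb C}(\mathbf e)$; $\mathcal L^{\mathbb R}_{\mathbf e}\subset\mathcal L^{\mathbb C}_{\mathbf e}$ consists of the symmetric ones. $\mathcal L^{\mathbb R}=\mathcal L^{\mathbb R}_{\mathbf e}[[\mu]]$ (resp. $\mathcal L^{\mathbb C}=\mathcal L^{\mathbb C}_{\mathbf e}[[\mu]]$) is a complete filtered Lie algebra over $\mathbb R$ (resp. $\mathbb C$) for the bracket $\frac1{i\hbar}[\cdot,\cdot]$, filtered by order in $\mu$; $\mathcal L^{\mathbb C}$ is also a complete filtered associative algebra. Write $B=\sum_{k,\ell\in J}\beta_{k,\ell}(\mu)\,|\ell\rangle\langle k|$, where $|\ell\rangle\langle k|\psi=(e_k,\psi)e_\ell$ and $\beta_{k,\ell}(\mu)=(e_\ell,Be_k)\in\mathbb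 C[[\mu]]$. Finite-band means: there is $D\in\mathbb N$ with $\beta_{k,\ell}=0$ whenever $|k-\ell|>D$. Set $$\mathcal N=\{\tfrac1{i\hbar}(E_0(\ell)-E_0(k)):(k,\ell)\in J\times J\},\qquad B_\lambda=\sum_{(k,\ell):\,E_0(\ell)-E_0(k)=i\hbar\lambda}\beta_{k,\ell}(\mu)\,|\ell\rangle\langle k| ,$$ so that $B=\sum_{\lambda\in\mathcal N}B_\lambda$ and $\frac1{i\hbar}[H_0,B_\lambda]=\lambda B_\lambda$. All sums over $\lambda$'s are understood as acting on basis vectors: on each $e_k$ and at each order in $\mu$ only finitely many terms contribute. "Unitary" for $C\in\mathcal L^{\mathbb C}$ means that $C$ is invertible in $\mathcal L^{\mathbb C}$ and $C^{-1}=C^*$, the adjoint being taken coefficientwise in $\mu$ (on $\mathrm{Span}_{\mathbb C}(\mathbf e)$); a unitary conjugation is a map $A\mapsto CAC^{-1}$ of $\mathcal L^{\mathbb C}$ with $C$ unitary. $\underline{\mathcal N}$ is the set of words (finite sequences) $\underline\lambda=\lambda_1\cdots\lambda_{r(\underline\lambda)}$ on $\mathcal N$, including the empty word $\varnothing$ of length $0$. The empty word contributes $0$ to $N$, contributes $S^\varnothing\,\mathrm{Id}=\mathrm{Id}$ to $\Psi$ and $C$, and a one-letter word contributes $N^{\lambda_1}B_{\lambda_1}$ to $N$. A $\mathbb C((\varepsilon))$-valued mould is a function $\underline\lambda\in\underline{\mathcal N}\mapsto M^{\underline\lambda}\in\mathbb C((\varepsilon))$; product $(M\times M')^{\underline\lambda}=\sum_{\underline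 a\,\underline b=\underline\lambda}M^{\underline a}M'^{\underline b}$. With $K_+=\mathbb C[[\varepsilon]]$, $K_-=\varepsilon^{-1}\mathbb C[\varepsilon^{-1}]$ and $T^\varnothing=1$, the Birkhoff decomposition of $T$ is the unique pair of moulds with $U_\pm^\varnothing=1$, $U_-^{\underline\lambda}\in K_-$, $U_+^{\underline\lambda}\in K_+$ for $\underline\lambda\neq\varnothing$, and $U_-\times T=U_+$; inductively, for $\underline\lambda\ne\varnothing$, $U_-^{\underline\lambda}=-\pi_-(D^{\underline\lambda})$ and $U_+^{\underline\lambda}=\pi_+(D^{\underline\lambda})$ with $D^{\underline\lambda}=\sum_{\underline\lambda=\underline a\,\underline b,\ \underline b\neq\varnothing}U_-^{\underline a}T^{\underline b}$, where $\pi_\pm$ are the projectors of $\mathbb C((\varepsilon))=K_+\oplus K_-$ onto $K_\pm$. Residue and constant term of $\sum_nc_n\varepsilon^n$ are $c_{-1}$ and $c_0$. *)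

theory Defs
  imports
    "HOL-Analysis.Analysis"
    "HOL-Algebra.Group"
    "HOL-Library.Function_Algebras"
    "HOL-Computational_Algebra.Formal_Laurent_Series"
begin

section \<open>Complex Hilbert spaces\<close>

text \<open>The inner product is linear in the second argument.\<close>

class complex_inner = real_normed_vector +
  fixes scaleC :: "complex \<Rightarrow> 'a \<Rightarrow> 'a" (infixr "*\<^sub>C" 75)
    and cinner :: "'a \<Rightarrow> 'a \<Rightarrow> complex"
  assumes scaleC_add_right: "c *\<^sub>C (x + y) = c *\<^sub>C x + c *\<^sub>C y"
    and scaleC_add_left: "(c + d) *\<^sub>C x = c *\<^sub>C x + d *\<^sub>C x"
    and scaleC_scaleC: "c *\<^sub>C d *\<^sub>C x = (c * d) *\<^sub>C x"
    and scaleR_scaleC: "r *\<^sub>R x = complex_of_real r *\<^sub>C x"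
    and cinner_add_right: "cinner x (y + z) = cinner x y + cinner x z"
    and cinner_scaleC_right: "cinner x (c *\<^sub>C y) = c * cinner x y"
    and cinner_commute: "cinner x y = cnj (cinner y x)"
    and cinner_self_nonneg: "0 \<le> Re (cinner x x)"
    and norm_eq_sqrt_cinner: "norm x = sqrt (Re (cinner x x))"

class complex_hilbert = complex_inner + complete_space

instantiation complex :: complex_hilbert
begin

definition scaleC_complex :: "complex \<Rightarrow> complex \<Rightarrow> complex" where
  "scaleC_complex c x = c * x"

definition cinner_complex :: "complex \<Rightarrow> complex \<Rightarrow> complex" where
  "cinner_complex x y = cnj x * y"

instance
  by standard
    (auto simp: scaleC_complex_def cinner_complex_def algebra_simps scaleR_conv_of_real
      cmod_def power2_eq_square)

end

interpretation complex_vector: vector_space "scaleC :: complex \<Rightarrow> 'a \<Rightarrow> 'a::complex_inner"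
proof
  fix x :: 'a
  show "1 *\<^sub>C x = x"
    using scaleR_scaleC[of 1 x] by simp
qed (simp_all add: scaleC_add_right scaleC_add_left scaleC_scaleC)

abbreviation cspan :: "'h::complex_inner set \<Rightarrow> 'h set" where
  "cspan \<equiv> module.span scaleC"

definition orthonormal_basis :: "'i set \<Rightarrow> ('i \<Rightarrow> 'h::complex_inner) \<Rightarrow> bool" where
  "orthonormal_basis J e \<longleftrightarrow>
     (\<forall>k\<in>J. \<forall>l\<in>J. cinner (e k) (e l) = (if k = l then 1 else 0)) \<and>
     closure (cspan (e ` J)) = UNIV"

text \<open>A possibly unbounded operator is given by its domain \<open>D\<close> and a function \<open>H\<close> whose values
  off \<open>D\<close> are irrelevant. Self-adjointness says that the graph of \<open>H\<close> on \<open>D\<close> coincides with the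
  graph of the adjoint, so that in particular the two domains agree.\<close>

definition self_adjoint :: "'h::complex_inner set \<Rightarrow> ('h \<Rightarrow> 'h) \<Rightarrow> bool" where
  "self_adjoint D H \<longleftrightarrow>
     module.subspace scaleC D \<and> closure D = UNIV \<and>
     (\<forall>x\<in>D. \<forall>y\<in>D. H (x + y) = H x + H y) \<and>
     (\<forall>c. \<forall>x\<in>D. H (c *\<^sub>C x) = c *\<^sub>C H x) \<and>
     (\<forall>x y. (x \<in> D \<and> y = H x) \<longleftrightarrow> (\<forall>z\<in>D. cinner x (H z) = cinner y z))"


section \<open>Operators on a dense subspace and formal series of operators\<close>

text \<open>Here \<open>V\<close> stands for the linear span of the basis. An operator with domain \<open>V\<close> is encoded as
  a total function vanishing off \<open>V\<close>, so that equality of operators is equality of functions.\<close>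

definition linops :: "'h::complex_inner set \<Rightarrow> ('h \<Rightarrow> 'h) set" where
  "linops V = {A. (\<forall>x\<in>V. A x \<in> V) \<and>
     (\<forall>x\<in>V. \<forall>y\<in>V. A (x + y) = A x + A y) \<and>
     (\<forall>c. \<forall>x\<in>V. A (c *\<^sub>C x) = c *\<^sub>C A x) \<and>
     (\<forall>x. x \<notin> V \<longrightarrow> A x = 0)}"

definition symops :: "'h::complex_inner set \<Rightarrow> ('h \<Rightarrow> 'h) set" where
  "symops V = {A \<in> linops V. \<forall>x\<in>V. \<forall>y\<in>V. cinner x (A y) = cinner (A x) y}"

definition restrict_op :: "'h set \<Rightarrow> ('h \<Rightarrow> 'h) \<Rightarrow> 'h \<Rightarrow> 'h::zero" where
  "restrict_op V A x = (if x \<in> V then A x else 0)"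

text \<open>Power series in the formal parameter with operator coefficients. Sums and differences are
  those of the type \<open>fps\<close> over pointwise operations on functions; the product is the Cauchy
  product built on composition.\<close>

type_synonym 'h opfps = "('h \<Rightarrow> 'h) fps"

definition LC :: "'h::complex_inner set \<Rightarrow> 'h opfps set" where
  "LC V = {A. \<forall>n. fps_nth A n \<in> linops V}"

definition LR :: "'h::complex_inner set \<Rightarrow> 'h opfps set" where
  "LR V = {A. \<forall>n. fps_nth A n \<in> symops V}"

definition op_mult :: "'h::complex_inner opfps \<Rightarrow> 'h opfps \<Rightarrow> 'h opfps" (infixl "\<odot>" 70) where
  "A \<odot> B = Abs_fps (\<lambda>n. \<Sum>i\<le>n. fps_nth A i \<circ> fps_nth B (n - i))"

definition op_one :: "'h::complex_inner set \<Rightarrow> 'h opfps" where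
  "op_one V = fps_const (restrict_op V id)"

definition op_scale :: "complex \<Rightarrow> 'h::complex_inner opfps \<Rightarrow> 'h opfps" where
  "op_scale c A = Abs_fps (\<lambda>n x. c *\<^sub>C fps_nth A n x)"

definition op_commutator :: "'h::complex_inner opfps \<Rightarrow> 'h opfps \<Rightarrow> 'h opfps" where
  "op_commutator A B = A \<odot> B - B \<odot> A"

definition op_bracket :: "real \<Rightarrow> 'h::complex_inner opfps \<Rightarrow> 'h opfps \<Rightarrow> 'h opfps" where
  "op_bracket hbar A B = op_scale (1 / (\<i> * of_real hbar)) (op_commutator A B)"

definition LC_monoid :: "'h::complex_inner set \<Rightarrow> 'h opfps monoid" where
  "LC_monoid V = \<lparr>carrier = LC V, monoid.mult = op_mult, one = op_one V\<rparr>"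

definition op_inverse :: "'h::complex_inner set \<Rightarrow> 'h opfps \<Rightarrow> 'h opfps" where
  "op_inverse V C = inv\<^bsub>LC_monoid V\<^esub> C"

definition op_adjoint :: "'h::complex_inner set \<Rightarrow> 'h opfps \<Rightarrow> 'h opfps \<Rightarrow> bool" where
  "op_adjoint V A A' \<longleftrightarrow>
     (\<forall>n. \<forall>x\<in>V. \<forall>y\<in>V. cinner x (fps_nth A n y) = cinner (fps_nth A' n x) y)"

definition op_unitary :: "'h::complex_inner set \<Rightarrow> 'h opfps \<Rightarrow> bool" where
  "op_unitary V C \<longleftrightarrow> C \<in> Units (LC_monoid V) \<and> op_adjoint V C (op_inverse V C)"

definition unitary_conjugation ::
    "'h::complex_inner set \<Rightarrow> ('h opfps \<Rightarrow> 'h opfps) \<Rightarrow> bool" where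
  "unitary_conjugation V \<Psi> \<longleftrightarrow>
     (\<exists>C. op_unitary V C \<and> (\<forall>A\<in>LC V. \<Psi> A = C \<odot> A \<odot> op_inverse V C))"

text \<open>Infinite sums of operator series: on each basis vector and at each order only finitely many
  terms may contribute. Every vector of the span then also meets only finitely many nonzero terms,
  so \<open>op_sum\<close> adds the terms that do not vanish at the given vector.\<close>

definition op_summable ::
    "nat set \<Rightarrow> (nat \<Rightarrow> 'h::complex_inner) \<Rightarrow> ('i \<Rightarrow> 'h opfps) \<Rightarrow> 'i set \<Rightarrow> bool" where
  "op_summable J e F I \<longleftrightarrow> (\<forall>n. \<forall>k\<in>J. finite {i\<in>I. fps_nth (F i) n (e k) \<noteq> 0})"

definition op_sum ::
    "'h::complex_inner set \<Rightarrow> ('i \<Rightarrow> 'h opfps) \<Rightarrow> 'i set \<Rightarrow> 'h opfps" where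
  "op_sum V F I = Abs_fps (\<lambda>n. restrict_op V
     (\<lambda>x. \<Sum>i\<in>{i\<in>I. fps_nth (F i) n x \<noteq> 0}. fps_nth (F i) n x))"


section \<open>Homogeneous components\<close>

definition ketbra :: "'h::complex_inner \<Rightarrow> 'h \<Rightarrow> 'h \<Rightarrow> 'h" where
  "ketbra u v x = cinner v x *\<^sub>C u"

definition matrix_coeff ::
    "(nat \<Rightarrow> 'h::complex_inner) \<Rightarrow> 'h opfps \<Rightarrow> nat \<Rightarrow> nat \<Rightarrow> complex fps" where
  "matrix_coeff e B k l = Abs_fps (\<lambda>n. cinner (e l) (fps_nth B n (e k)))"

definition finite_band ::
    "nat set \<Rightarrow> (nat \<Rightarrow> 'h::complex_inner) \<Rightarrow> 'h opfps \<Rightarrow> bool" where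
  "finite_band J e B \<longleftrightarrow> (\<exists>D::nat. \<forall>k\<in>J. \<forall>l\<in>J.
     \<bar>int k - int l\<bar> > int D \<longrightarrow> matrix_coeff e B k l = 0)"

definition eigen_alphabet :: "real \<Rightarrow> nat set \<Rightarrow> (nat \<Rightarrow> real) \<Rightarrow> complex set" where
  "eigen_alphabet hbar J E0 =
     {1 / (\<i> * of_real hbar) * of_real (E0 l - E0 k) | k l. k \<in> J \<and> l \<in> J}"

definition hom_comp ::
    "real \<Rightarrow> nat set \<Rightarrow> (nat \<Rightarrow> real) \<Rightarrow> (nat \<Rightarrow> 'h::complex_inner) \<Rightarrow> 'h opfps \<Rightarrow> complex \<Rightarrow> 'h opfps"
  where
  "hom_comp hbar J E0 e B lam = op_sum (cspan (e ` J))
     (\<lambda>(k, l). Abs_fps (\<lambda>n x. fps_nth (matrix_coeff e B k l) n *\<^sub>C ketbra (e l) (e k) x))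
     {(k, l). k \<in> J \<and> l \<in> J \<and> of_real (E0 l - E0 k) = \<i> * of_real hbar * lam}"

fun nested_bracket ::
    "real \<Rightarrow> (complex \<Rightarrow> 'h::complex_inner opfps) \<Rightarrow> complex list \<Rightarrow> 'h opfps" where
  "nested_bracket hbar Bc [] = 0"
| "nested_bracket hbar Bc [a] = Bc a"
| "nested_bracket hbar Bc (a # b # w) = op_bracket hbar (Bc a) (nested_bracket hbar Bc (b # w))"

fun nested_ad ::
    "real \<Rightarrow> (complex \<Rightarrow> 'h::complex_inner opfps) \<Rightarrow> complex list \<Rightarrow> 'h opfps \<Rightarrow> 'h opfps" where
  "nested_ad hbar Bc [] A = A"
| "nested_ad hbar Bc (a # w) A = op_bracket hbar (Bc a) (nested_ad hbar Bc w A)"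

fun word_product ::
    "'h::complex_inner set \<Rightarrow> (complex \<Rightarrow> 'h opfps) \<Rightarrow> complex list \<Rightarrow> 'h opfps" where
  "word_product V Bc [] = op_one V"
| "word_product V Bc (a # w) = Bc a \<odot> word_product V Bc w"


section \<open>Moulds and Birkhoff decomposition\<close>

type_synonym mould = "complex list \<Rightarrow> complex fls"

definition mould_mult :: "mould \<Rightarrow> mould \<Rightarrow> mould" where
  "mould_mult M M' w = (\<Sum>i\<le>length w. M (take i w) * M' (drop i w))"

text \<open>A Laurent series has only finitely many negative powers, so series without nonnegative
  powers are exactly the polynomials in the inverse variable without constant term.\<close>

definition K_plus :: "complex fls set" where
  "K_plus = range fps_to_fls"

definition K_minus :: "complex fls set" where
  "K_minus = {f. \<forall>n\<ge>0. fls_nth f n = 0}"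

definition birkhoff_decomposition :: "complex set \<Rightarrow> mould \<Rightarrow> mould \<Rightarrow> mould \<Rightarrow> bool" where
  "birkhoff_decomposition \<N> T Um Up \<longleftrightarrow>
     Um [] = 1 \<and> Up [] = 1 \<and>
     (\<forall>w\<in>lists \<N>. w \<noteq> [] \<longrightarrow> Um w \<in> K_minus \<and> Up w \<in> K_plus) \<and>
     (\<forall>w\<in>lists \<N>. mould_mult Um T w = Up w)"

definition T_mould :: mould where
  "T_mould w = (\<Prod>i\<in>{1..length w}.
     1 / (fls_const (sum_list (take i w)) + of_nat i * fls_X))"

definition minus_part :: "complex fls \<Rightarrow> complex fls" where
  "minus_part f = f - fps_to_fls (fls_regpart f)"

function birkhoff_minus :: "mould \<Rightarrow> mould" where
  "birkhoff_minus T w = (if w = [] then 1 else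
     - minus_part (\<Sum>i<length w. birkhoff_minus T (take i w) * T (drop i w)))"
  by pat_completeness auto
termination by (relation "Wellfounded.measure (\<lambda>(T, w). length w)") auto

declare birkhoff_minus.simps [simp del]

lemma mould_mult_split:
  assumes "T [] = 1"
  shows "mould_mult U T w = U w + (\<Sum>i<length w. U (take i w) * T (drop i w))"
proof -
  have "{..length w} = insert (length w) {..<length w}" by auto
  then show ?thesis by (simp add: mould_mult_def assms)
qed

lemma minus_part_in: "minus_part f \<in> K_minus"
  by (auto simp: minus_part_def K_minus_def)

lemma K_plus_minus: "f \<in> K_plus \<Longrightarrow> f \<in> K_minus \<Longrightarrow> f = 0"
  by (auto simp: K_plus_def K_minus_def fls_eq_iff split: if_splits)

lemma K_plus_diff: "f \<in> K_plus \<Longrightarrow> g \<in> K_plus \<Longrightarrow> f - g \<in> K_plus"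
  by (auto simp: K_plus_def simp del: fps_to_fls_minus simp add: fps_to_fls_minus[symmetric])

lemma K_minus_diff: "f \<in> K_minus \<Longrightarrow> g \<in> K_minus \<Longrightarrow> f - g \<in> K_minus"
  by (auto simp: K_minus_def)

lemma birkhoff_decomposition_exists:
  assumes "T [] = 1"
  shows "birkhoff_decomposition \<N> T (birkhoff_minus T) (mould_mult (birkhoff_minus T) T)"
proof -
  have 1: "birkhoff_minus T [] = 1" by (simp add: birkhoff_minus.simps)
  have 2: "birkhoff_minus T w \<in> K_minus" if "w \<noteq> []" for w
    using that minus_part_in[of "\<Sum>i<length w. birkhoff_minus T (take i w) * T (drop i w)"]
    by (subst birkhoff_minus.simps) (simp add: K_minus_def)
  have 3: "mould_mult (birkhoff_minus T) T w \<in> K_plus" if "w \<noteq> []" for w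
    using that unfolding mould_mult_split[of T, OF assms]
    by (subst birkhoff_minus.simps) (simp add: minus_part_def K_plus_def)
  show ?thesis
    unfolding birkhoff_decomposition_def
    using 1 2 3 by (auto simp: mould_mult_def assms)
qed

lemma birkhoff_decomposition_unique:
  assumes T: "T [] = 1"
    and U: "birkhoff_decomposition \<N> T Um Up"
    and V: "birkhoff_decomposition \<N> T Vm Vp"
    and w: "w \<in> lists \<N>"
  shows "Um w = Vm w \<and> Up w = Vp w"
  using w
proof (induction "length w" arbitrary: w rule: less_induct)
  case less
  show ?case
  proof (cases "w = []")
    case True
    then show ?thesis using U V by (simp add: birkhoff_decomposition_def)
  next
    case False
    have eq: "Um (take i w) = Vm (take i w)" if "i < length w" for i
      using less.hyps[of "take i w"] less.prems that by (auto dest: in_set_takeD)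
    have mU: "mould_mult Um T w = Up w" and mV: "mould_mult Vm T w = Vp w"
      using U V less.prems unfolding birkhoff_decomposition_def by blast+
    have "Up w - Um w = Vp w - Vm w"
      unfolding mU[symmetric] mV[symmetric] mould_mult_split[of T, OF T] by (simp add: eq)
    then have *: "Up w - Vp w = Um w - Vm w" by (simp add: algebra_simps)
    have "Up w - Vp w \<in> K_plus" "Um w - Vm w \<in> K_minus"
      using U V less.prems False unfolding birkhoff_decomposition_def
      by (auto intro!: K_plus_diff K_minus_diff)
    then have "Up w - Vp w = 0" using * K_plus_minus by metis
    then show ?thesis using * by simp
  qed
qed

lemma T_mould_Nil: "T_mould [] = 1"
  by (simp add: T_mould_def)

end

theory Submission
  imports Defs
begin

text \<open>The mould \<open>T\<close> solves \<open>DT = T \<star> I\<close>, where the derivation \<open>D\<close> multiplies the value on a word \<open>w\<close>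
  of length \<open>r\<close> by the sum of its letters plus \<open>r \<epsilon>\<close>, and \<open>I\<close> is the indicator of one-letter words.
  Hence \<open>T\<close> is symmetral and its convolution inverse is given by reversing words and alternating
  signs. Since \<open>K\<^sub>+\<close> and \<open>K\<^sub>-\<close> meet in \<open>0\<close>, both properties pass to \<open>U\<^sub>\<plusminus>\<close>, so \<open>S\<close> is symmetral and \<open>N\<close>
  alternal. Applying \<open>D\<close> to \<open>U\<^sub>+ = U\<^sub>- \<star> T\<close> gives \<open>DU\<^sub>- = G \<star> U\<^sub>-\<close> and \<open>DU\<^sub>+ = G \<star> U\<^sub>+ + U\<^sub>+ \<star> I\<close> for one and
  the same \<open>G\<close>, which has neither positive nor negative powers of \<open>\<epsilon>\<close>. The first equation identifies
  \<open>G\<close> with \<open>-F\<close>, where \<open>F\<close> is \<open>r N\<close>, and the constant term of the second reads \<open>F \<star> S = S \<star> I - \<nabla>S\<close>,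
  with \<open>\<nabla>\<close> the multiplication by the sum of the letters.
  Substituting the operators \<open>B\<^sub>\<lambda>\<close> for the letters turns convolution into composition and \<open>\<nabla>\<close> into the
  commutator with \<open>H\<^sub>0\<close>, so this equation becomes the conjugation of \<open>H\<^sub>0 + B\<close> to \<open>H\<^sub>0 + N\<close>. Symmetrality
  of \<open>S\<close> and alternality of \<open>N\<close> turn the sums of nested brackets into \<open>C A C\<^sup>-\<^sup>1\<close> and into the sum of
  products with coefficients \<open>F\<close>.\<close>

section \<open>Convolution of functions on words\<close>

text \<open>The product of moulds over any commutative ring, so that moulds with values in Laurent
  series and in complex numbers share one calculus.\<close>

definition mconv :: "('a list \<Rightarrow> 'b::comm_ring_1) \<Rightarrow> ('a list \<Rightarrow> 'b) \<Rightarrow> 'a list \<Rightarrow> 'b" (infixl "\<star>" 70)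
  where "(M \<star> M') w = (\<Sum>i\<le>length w. M (take i w) * M' (drop i w))"

definition munit :: "'a list \<Rightarrow> 'b::comm_ring_1" where
  "munit w = (if w = [] then 1 else 0)"

definition mletter :: "'a list \<Rightarrow> 'b::comm_ring_1" where
  "mletter w = (if length w = 1 then 1 else 0)"

text \<open>The antipode of the shuffle Hopf algebra, carried over to moulds: it inverts symmetral
  moulds and negates alternal ones.\<close>

definition mantipode :: "('a list \<Rightarrow> 'b::comm_ring_1) \<Rightarrow> 'a list \<Rightarrow> 'b" where
  "mantipode M w = (-1) ^ length w * M (rev w)"

lemma mould_mult_eq_mconv: "mould_mult M M' = M \<star> M'"
  by (rule ext) (simp add: mould_mult_def mconv_def)

lemma munit_Nil [simp]: "munit [] = 1" and munit_Cons [simp]: "munit (x # w) = 0"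
  and munit_snoc [simp]: "munit (w @ [x]) = 0"
  by (simp_all add: munit_def)

lemma mletter_Nil [simp]: "mletter [] = 0"
  and mletter_Cons: "mletter (x # w) = munit w"
  and mletter_snoc: "mletter (w @ [x]) = munit w"
  by (simp_all add: mletter_def munit_def)

lemma mantipode_Nil [simp]: "mantipode M [] = M []"
  by (simp add: mantipode_def)

lemma mconv_Nil [simp]: "(M \<star> M') [] = M [] * M' []"
  by (simp add: mconv_def)

lemma mconv_Cons: "(M \<star> M') (x # w) = M [] * M' (x # w) + ((\<lambda>v. M (x # v)) \<star> M') w"
proof -
  have "(M \<star> M') (x # w) = (\<Sum>i\<le>Suc (length w). M (take i (x # w)) * M' (drop i (x # w)))"
    by (simp add: mconv_def)
  also have "\<dots> = M [] * M' (x # w) + (\<Sum>i\<le>length w. M (x # take i w) * M' (drop i w))"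
    by (subst sum.atMost_Suc_shift) simp
  finally show ?thesis by (simp add: mconv_def)
qed

lemma mconv_snoc: "(M \<star> M') (w @ [x]) = (M \<star> (\<lambda>v. M' (v @ [x]))) w + M (w @ [x]) * M' []"
  by (simp add: mconv_def)

lemma mconv_add_left: "((\<lambda>v. M v + M' v) \<star> P) w = (M \<star> P) w + (M' \<star> P) w"
  by (simp add: mconv_def distrib_right sum.distrib)

lemma mconv_uminus_left: "((\<lambda>v. - M v) \<star> P) w = - (M \<star> P) w"
  by (simp add: mconv_def sum_negf)

lemma mconv_uminus_right: "(P \<star> (\<lambda>v. - M v)) w = - (P \<star> M) w"
  by (simp add: mconv_def sum_negf)

lemma mconv_scale_left: "((\<lambda>v. c * M v) \<star> P) w = c * (M \<star> P) w"
  by (simp add: mconv_def sum_distrib_left mult.assoc)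

text \<open>Peeling off the first letter replaces \<open>M\<close> by its shift, hence the induction
  on the word for all \<open>M\<close> at once.\<close>

lemma mconv_assoc: "(M \<star> M') \<star> P = M \<star> (M' \<star> P)"
proof
  fix w show "((M \<star> M') \<star> P) w = (M \<star> (M' \<star> P)) w"
  proof (induction w arbitrary: M)
    case (Cons x w)
    have "(\<lambda>v. (M \<star> M') (x # v)) = (\<lambda>v. M [] * M' (x # v) + ((\<lambda>u. M (x # u)) \<star> M') v)"
      by (simp add: mconv_Cons)
    then show ?case
      by (simp add: mconv_Cons mconv_add_left mconv_scale_left Cons.IH algebra_simps)
  qed (simp add: mult.assoc)
qed

lemma mconv_munit_left [simp]: "munit \<star> M = M"
proof
  fix w :: "'a list"
  have "(munit \<star> M) w = (\<Sum>i\<le>length w. if i = 0 then M w else 0)"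
    unfolding mconv_def by (rule sum.cong) (auto simp: munit_def)
  then show "(munit \<star> M) w = M w" by simp
qed

lemma mconv_munit_right [simp]: "M \<star> munit = M"
proof
  fix w :: "'a list"
  have "(M \<star> munit) w = (\<Sum>i\<le>length w. if i = length w then M w else 0)"
    unfolding mconv_def by (rule sum.cong) (auto simp: munit_def)
  then show "(M \<star> munit) w = M w" by simp
qed

lemma mconv_mletter_snoc: "(M \<star> mletter) (w @ [x]) = M w"
  by (simp add: mconv_snoc mletter_snoc)

lemma mconv_mletter_Cons: "(mletter \<star> M) (x # w) = M w"
  by (simp add: mconv_Cons mletter_Cons)

lemma mantipode_mconv: "mantipode (M \<star> M') = mantipode M' \<star> mantipode M"
proof
  fix w :: "'a list"
  have "mantipode (M \<star> M') w = (\<Sum>i\<le>length w. (-1) ^ length w * (M (take i (rev w)) * M' (drop i (rev w))))"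
    by (simp add: mantipode_def mconv_def sum_distrib_left)
  \<comment> \<open>Count the cut from the other end, since reversal exchanges prefixes and
    suffixes.\<close>
  also have "\<dots> = (\<Sum>i\<le>length w. (-1) ^ length w *
      (M (take (length w - i) (rev w)) * M' (drop (length w - i) (rev w))))"
    by (rule sum.reindex_bij_witness[where i = "\<lambda>i. length w - i" and j = "\<lambda>i. length w - i"]) auto
  also have "\<dots> = (\<Sum>i\<le>length w. mantipode M' (take i w) * mantipode M (drop i w))"
  proof (rule sum.cong)
    fix i assume "i \<in> {..length w}"
    then have i: "i \<le> length w" by simp
    then have "(-1 :: 'b) ^ length w = (-1) ^ i * (-1) ^ (length w - i)"
      by (simp flip: power_add)
    then show "(-1) ^ length w * (M (take (length w - i) (rev w)) * M' (drop (length w - i) (rev w)))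
        = mantipode M' (take i w) * mantipode M (drop i w)"
      using i by (simp add: mantipode_def rev_take rev_drop algebra_simps)
  qed simp
  finally show "mantipode (M \<star> M') w = (mantipode M' \<star> mantipode M) w"
    by (simp add: mconv_def)
qed

text \<open>The product \<open>?Z\<close> in the other order satisfies
  \<open>?Z \<star> M' = M'\<close>. By induction \<open>?Z\<close> vanishes on the shorter nonempty
  prefixes of a nonempty \<open>w\<close>, so this equation at \<open>w\<close> reads
  \<open>M' w + ?Z w = M' w\<close>.\<close>

lemma mconv_inverse_commute:
  assumes 1: "M \<star> M' = munit" and "M [] = 1" and M': "M' [] = 1"
  shows "M' \<star> M = munit"
proof
  let ?Z = "M' \<star> M"
  have Z0: "?Z [] = 1" using assms by simp
  have Z: "?Z \<star> M' = M'" by (simp add: mconv_assoc 1)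
  fix w show "?Z w = munit w"
  proof (induction w rule: length_induct)
    case (1 w)
    show ?case
    proof (cases "w = []")
      case False
      have "(\<Sum>i<length w. ?Z (take i w) * M' (drop i w)) = (\<Sum>i<length w. if i = 0 then M' w else 0)"
        using 1 Z0 by (intro sum.cong) (auto simp: munit_def)
      also have "\<dots> = M' w" using False by simp
      finally have "(?Z \<star> M') w = M' w + ?Z w"
        unfolding mconv_def lessThan_Suc_atMost[symmetric] sum.lessThan_Suc by (simp add: M')
      then show ?thesis using Z False by (simp add: munit_def)
    qed (use Z0 in simp)
  qed
qed

text \<open>A function additive under concatenation distributes over every cut of the word, so
  multiplication by it obeys the Leibniz rule for convolution.\<close>

lemma mconv_weight:
  fixes d :: "'a list \<Rightarrow> 'b::comm_ring_1"
  assumes d: "\<And>u v. d (u @ v) = d u + d v"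
  shows "d w * (M \<star> M') w = ((\<lambda>w. d w * M w) \<star> M') w + (M \<star> (\<lambda>w. d w * M' w)) w"
proof -
  have "d w = d (take i w) + d (drop i w)" for i
    by (metis append_take_drop_id d)
  then have "d w * (M (take i w) * M' (drop i w)) = d (take i w) * M (take i w) * M' (drop i w)
      + M (take i w) * (d (drop i w) * M' (drop i w))" for i
    by (metis (no_types, opaque_lifting) distrib_right mult.assoc mult.left_commute)
  then show ?thesis
    by (simp add: mconv_def sum_distrib_left sum.distrib)
qed

section \<open>Shuffles\<close>

text \<open>A shuffle of two words is encoded as a word of letters tagged by the factor they come from,
  so that shuffles which coincide as words are counted with their multiplicity.\<close>

definition untag :: "('a \<times> bool) list \<Rightarrow> 'a list" where
  "untag p = map fst p"

definition word1 :: "('a \<times> bool) list \<Rightarrow> 'a list" where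
  "word1 p = map fst (filter snd p)"

definition word2 :: "('a \<times> bool) list \<Rightarrow> 'a list" where
  "word2 p = map fst (filter (\<lambda>x. \<not> snd x) p)"

definition tagged_shuffles :: "'a list \<Rightarrow> 'a list \<Rightarrow> ('a \<times> bool) list set" where
  "tagged_shuffles a b = {p. word1 p = a \<and> word2 p = b}"

text \<open>A mould is symmetral when this equals \<open>M a * M b\<close>, and alternal when it
  vanishes for nonempty \<open>a\<close> and \<open>b\<close>.\<close>

definition shuffle_sum :: "('a list \<Rightarrow> 'b::comm_ring_1) \<Rightarrow> 'a list \<Rightarrow> 'a list \<Rightarrow> 'b" where
  "shuffle_sum M a b = (\<Sum>p\<in>tagged_shuffles a b. M (untag p))"

lemma untag_simps [simp]: "untag [] = []" "untag (x # p) = fst x # untag p"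
  "untag (p @ q) = untag p @ untag q" "untag (take i p) = take i (untag p)"
  "untag (drop i p) = drop i (untag p)" "length (untag p) = length p"
  by (simp_all add: untag_def take_map drop_map)

lemma word_simps [simp]: "word1 [] = []" "word2 [] = []"
  "word1 ((x, True) # p) = x # word1 p" "word1 ((x, False) # p) = word1 p"
  "word2 ((x, True) # p) = word2 p" "word2 ((x, False) # p) = x # word2 p"
  "word1 (p @ q) = word1 p @ word1 q" "word2 (p @ q) = word2 p @ word2 q"
  by (simp_all add: word1_def word2_def)

lemma length_word12: "length p = length (word1 p) + length (word2 p)"
  by (induction p) (auto simp: word1_def word2_def)

lemma set_word12: "fst ` set p = set (word1 p) \<union> set (word2 p)"
  by (auto simp: word1_def word2_def image_iff)

lemma finite_tagged_shuffles [simp]: "finite (tagged_shuffles a b)"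
proof (rule finite_subset)
  show "finite {p. set p \<subseteq> (set a \<union> set b) \<times> (UNIV :: bool set) \<and> length p = length a + length b}"
    by (intro finite_lists_length_eq finite_cartesian_product) auto
  show "tagged_shuffles a b \<subseteq> {p. set p \<subseteq> (set a \<union> set b) \<times> (UNIV :: bool set) \<and> length p = length a + length b}"
  proof
    fix p assume "p \<in> tagged_shuffles a b"
    then have ab: "a = word1 p" "b = word2 p" by (simp_all add: tagged_shuffles_def)
    have "set p \<subseteq> (fst ` set p) \<times> UNIV" by force
    then show "p \<in> {p. set p \<subseteq> (set a \<union> set b) \<times> (UNIV :: bool set) \<and> length p = length a + length b}"
      unfolding ab by (simp add: set_word12 flip: length_word12)
  qed
qed

lemma tagged_shuffles_Nil1: "tagged_shuffles [] b = {map (\<lambda>x. (x, False)) b}"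
proof -
  have "p = map (\<lambda>x. (x, False)) (word2 p)" if "word1 p = []" for p :: "('a \<times> bool) list"
    using that
  proof (induction p)
    case (Cons x p) then show ?case by (cases x; cases "snd x") auto
  qed simp
  moreover have "word1 (map (\<lambda>x. (x, False)) b) = []" "word2 (map (\<lambda>x. (x, False)) b) = b"
    by (induction b) auto
  ultimately show ?thesis by (auto simp: tagged_shuffles_def)
qed

lemma tagged_shuffles_Nil2: "tagged_shuffles a [] = {map (\<lambda>x. (x, True)) a}"
proof -
  have "p = map (\<lambda>x. (x, True)) (word1 p)" if "word2 p = []" for p :: "('a \<times> bool) list"
    using that
  proof (induction p)
    case (Cons x p) then show ?case by (cases x; cases "snd x") auto
  qed simp
  moreover have "word1 (map (\<lambda>x. (x, True)) a) = a" "word2 (map (\<lambda>x. (x, True)) a) = []"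
    by (induction a) auto
  ultimately show ?thesis by (auto simp: tagged_shuffles_def)
qed

text \<open>The last letter of a shuffle comes from the end of one of the two factors, and its tag
  tells from which.\<close>

lemma tagged_shuffles_snoc:
  "tagged_shuffles (a @ [x]) (b @ [y]) =
     (\<lambda>p. p @ [(x, True)]) ` tagged_shuffles a (b @ [y]) \<union>
     (\<lambda>p. p @ [(y, False)]) ` tagged_shuffles (a @ [x]) b" (is "?L = ?R")
proof
  show "?L \<subseteq> ?R"
  proof
    fix p assume p: "p \<in> ?L"
    show "p \<in> ?R"
    proof (cases p rule: rev_cases)
      case Nil then show ?thesis using p by (simp add: tagged_shuffles_def)
    next
      case (snoc q z)
      then show ?thesis using p
        by (cases z; cases "snd z") (auto simp: tagged_shuffles_def)
    qed
  qed
qed (auto simp: tagged_shuffles_def)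

lemma shuffle_sum_Nil1 [simp]: "shuffle_sum M [] b = M b"
  by (simp add: shuffle_sum_def tagged_shuffles_Nil1 untag_def comp_def)

lemma shuffle_sum_Nil2 [simp]: "shuffle_sum M a [] = M a"
  by (simp add: shuffle_sum_def tagged_shuffles_Nil2 untag_def comp_def)

text \<open>The two families of shuffles are disjoint by the tag of the last letter, even if
  \<open>x = y\<close>.\<close>

lemma shuffle_sum_snoc:
  "shuffle_sum M (a @ [x]) (b @ [y]) =
     shuffle_sum (\<lambda>w. M (w @ [x])) a (b @ [y]) + shuffle_sum (\<lambda>w. M (w @ [y])) (a @ [x]) b"
  unfolding shuffle_sum_def tagged_shuffles_snoc
  by (subst sum.union_disjoint) (auto simp: sum.reindex inj_on_def)

text \<open>Compatibility of shuffling with deconcatenation: cutting a shuffle of \<open>a\<close>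
  and \<open>b\<close> amounts to cutting \<open>a\<close> and \<open>b\<close> and choosing a
  shuffle of the two prefixes and one of the two suffixes. \<open>?f\<close> and \<open>?g\<close>
  are the two directions of this bijection.\<close>

lemma shuffle_sum_mconv:
  fixes M M' :: "'a list \<Rightarrow> 'b::comm_ring_1"
  shows "shuffle_sum (M \<star> M') a b = (\<Sum>j\<le>length a. \<Sum>k\<le>length b.
     shuffle_sum M (take j a) (take k b) * shuffle_sum M' (drop j a) (drop k b))"
proof -
  let ?A = "Sigma (tagged_shuffles a b) (\<lambda>p. {..length p})"
  let ?B = "Sigma ({..length a} \<times> {..length b})
    (\<lambda>(j, k). tagged_shuffles (take j a) (take k b) \<times> tagged_shuffles (drop j a) (drop k b))"
  let ?f = "\<lambda>(p :: ('a \<times> bool) list, i). ((length (word1 (take i p)), length (word2 (take i p))), (take i p, drop i p))"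
  let ?g = "\<lambda>((j :: nat, k :: nat), (p :: ('a \<times> bool) list, q)). (p @ q, length p)"
  have "shuffle_sum (M \<star> M') a b = (\<Sum>(p, i)\<in>?A. M (untag (take i p)) * M' (untag (drop i p)))"
    by (simp add: shuffle_sum_def mconv_def sum.Sigma)
  also have "\<dots> = (\<Sum>((j, k), (p, q))\<in>?B. M (untag p) * M' (untag q))"
  proof (rule sum.reindex_bij_witness[where i = ?g and j = ?f])
    fix x assume "x \<in> ?A"
    then obtain p i where x: "x = (p, i)" "p \<in> tagged_shuffles a b" "i \<le> length p" by auto
    have "a = word1 (take i p) @ word1 (drop i p)" "b = word2 (take i p) @ word2 (drop i p)"
      using x(2) by (simp_all add: tagged_shuffles_def flip: word_simps)
    then show "?f x \<in> ?B"
      by (auto simp: x(1) tagged_shuffles_def)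
  next
    fix y assume "y \<in> ?B"
    then obtain j k p q where y: "y = ((j, k), (p, q))" "j \<le> length a" "k \<le> length b"
      "word1 p = take j a" "word2 p = take k b" "word1 q = drop j a" "word2 q = drop k b"
      by (auto simp: tagged_shuffles_def)
    then show "?g y \<in> ?A" and "?f (?g y) = y"
      by (auto simp: tagged_shuffles_def)
  qed auto
  also have "\<dots> = (\<Sum>(j, k)\<in>{..length a} \<times> {..length b}. \<Sum>(p, q)\<in>tagged_shuffles (take j a) (take k b)
      \<times> tagged_shuffles (drop j a) (drop k b). M (untag p) * M' (untag q))"
    by (simp add: case_prod_unfold sum.Sigma)
  also have "\<dots> = (\<Sum>j\<le>length a. \<Sum>k\<le>length b.
     shuffle_sum M (take j a) (take k b) * shuffle_sum M' (drop j a) (drop k b))"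
    by (simp add: sum.cartesian_product shuffle_sum_def sum_product case_prod_unfold split_def)
  finally show ?thesis .
qed


notation fls_nth (infixl "$$" 75)


section \<open>Birkhoff decomposition of the mould T\<close>

lemma K_plus_iff: "f \<in> K_plus \<longleftrightarrow> (\<forall>n<0. f $$ n = 0)"
proof
  assume "\<forall>n<0. f $$ n = 0"
  then have "f = fps_to_fls (fls_regpart f)" by (auto simp: fls_eq_iff)
  then show "f \<in> K_plus" unfolding K_plus_def by blast
qed (auto simp: K_plus_def)

lemma K_plus_mult: "f \<in> K_plus \<Longrightarrow> g \<in> K_plus \<Longrightarrow> f * g \<in> K_plus"
  by (auto simp: K_plus_def simp flip: fls_times_fps_to_fls)

lemma K_plus_sum: "(\<And>i. i \<in> I \<Longrightarrow> f i \<in> K_plus) \<Longrightarrow> sum f I \<in> K_plus"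
  by (auto simp: K_plus_iff fls_nth_sum)

lemma K_plus_mult_nth0:
  assumes "f \<in> K_plus" "g \<in> K_plus"
  shows "(f * g) $$ 0 = f $$ 0 * g $$ 0"
  using assms by (auto simp: K_plus_def simp flip: fls_times_fps_to_fls)

lemma fls_times_nth_above:
  fixes f g :: "'a::comm_ring_1 fls"
  assumes f: "\<And>i. i > a \<Longrightarrow> f $$ i = 0" and g: "\<And>i. i > b \<Longrightarrow> g $$ i = 0" and n: "n > a + b"
  shows "(f * g) $$ n = 0"
  unfolding fls_times_nth(2)
proof (rule sum.neutral, rule ballI)
  fix i
  have "i > a \<or> n - i > b" using n by linarith
  then show "f $$ i * g $$ (n - i) = 0" using f g by auto
qed

text \<open>The product of two elements of \<open>K_minus\<close> starts at the power -2 going down.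
  In particular it has no residue, which is the source of the alternality of
  \<open>N_coef\<close>.\<close>

lemma K_minus_mult_nth:
  assumes "f \<in> K_minus" "g \<in> K_minus" "n \<ge> -1"
  shows "(f * g) $$ n = 0"
  by (rule fls_times_nth_above[of "-1" _ "-1"]) (use assms in \<open>auto simp: K_minus_def\<close>)

lemma K_minus_mult: "f \<in> K_minus \<Longrightarrow> g \<in> K_minus \<Longrightarrow> f * g \<in> K_minus"
  using K_minus_mult_nth[of f g] unfolding K_minus_def by force

lemma K_minus_uminus: "f \<in> K_minus \<Longrightarrow> - f \<in> K_minus"
  by (auto simp: K_minus_def)

lemma K_minus_sum: "(\<And>i. i \<in> I \<Longrightarrow> f i \<in> K_minus) \<Longrightarrow> sum f I \<in> K_minus"
  by (auto simp: K_minus_def fls_nth_sum)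

section \<open>The weight derivation and the mould T\<close>

definition weight :: "complex list \<Rightarrow> complex fls" where
  "weight w = fls_const (sum_list w) + of_nat (length w) * fls_X"

lemma weight_Nil [simp]: "weight [] = 0"
  by (simp add: weight_def)

text \<open>This additivity makes multiplication by the weight a derivation of the convolution
  algebra.\<close>

lemma weight_append: "weight (u @ v) = weight u + weight v"
  by (simp add: weight_def algebra_simps flip: fls_plus_const)

lemma weight_Cons: "weight (x # v) = fls_const x + fls_X + weight v"
  using weight_append[of "[x]" v] by (simp add: weight_def)

lemma weight_rev: "weight (rev w) = weight w"
  by (simp add: weight_def sum_list_rev)

lemma weight_untag: "weight (untag p) = weight (word1 p) + weight (word2 p)"
proof (induction p)
  case (Cons z p)
  then show ?case
    by (cases z; cases "snd z") (simp_all add: weight_Cons algebra_simps)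
qed simp

lemma weight_mult_nth:
  "(weight w * f) $$ n = sum_list w * f $$ n + of_nat (length w) * f $$ (n - 1)"
proof -
  have "weight w * f = fls_const (sum_list w) * f + of_nat (length w) * (fls_X * f)"
    by (simp only: weight_def distrib_right mult.assoc)
  then show ?thesis by (simp add: fls_X_times_conv_shift(1))
qed

text \<open>The coefficient of \<open>\<epsilon>\<close> is the length, so the weight stays
  invertible even for words whose letters sum to zero.\<close>

lemma weight_nonzero: "w \<noteq> [] \<Longrightarrow> weight w \<noteq> 0"
proof
  assume "w \<noteq> []" "weight w = 0"
  then have "weight w $$ 1 = 0" by simp
  then show False using \<open>w \<noteq> []\<close> by (simp add: weight_def)
qed

text \<open>The last denominator of T is the weight of the whole word; the others are those of the
  prefix.\<close>

lemma T_mould_snoc: "weight (w @ [x]) * T_mould (w @ [x]) = T_mould w"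
proof -
  have "T_mould (w @ [x]) = (\<Prod>i\<in>{1..length w}.
       1 / (fls_const (sum_list (take i (w @ [x]))) + of_nat i * fls_X)) * (1 / weight (w @ [x]))"
    by (simp add: T_mould_def weight_def)
  also have "(\<Prod>i\<in>{1..length w}. 1 / (fls_const (sum_list (take i (w @ [x]))) + of_nat i * fls_X))
      = T_mould w"
    unfolding T_mould_def by (rule prod.cong) auto
  finally show ?thesis using weight_nonzero[of "w @ [x]"] by simp
qed

lemma weight_T_mould: "weight w * T_mould w = (T_mould \<star> mletter) w"
  by (cases w rule: rev_cases) (simp_all add: mconv_mletter_snoc T_mould_snoc del: weight_append)

text \<open>The mirror image of \<open>weight_T_mould\<close>: reversal leaves the weight unchanged
  and turns the last letter into the first, and the lost letter gives the sign.\<close>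

lemma weight_antipode_T: "weight w * mantipode T_mould w = - (mletter \<star> mantipode T_mould) w"
proof (cases w)
  case (Cons x v)
  have "weight (x # v) = weight (rev v @ [x])"
    using weight_rev[of "x # v"] by simp
  then have "weight w * mantipode T_mould w
      = - ((-1) ^ length v * (weight (rev v @ [x]) * T_mould (rev v @ [x])))"
    by (simp add: Cons mantipode_def)
  then show ?thesis
    by (simp add: T_mould_snoc Cons mconv_mletter_Cons) (simp add: mantipode_def)
qed simp

text \<open>The weight acts as a derivation of the convolution algebra that kills this convolution.\<close>

lemma T_mould_antipode: "T_mould \<star> mantipode T_mould = munit"
proof
  fix w
  let ?T = "T_mould" and ?A = "mantipode T_mould"
  have "weight w * (?T \<star> ?A) w = (?T \<star> mletter \<star> ?A) w + (?T \<star> (\<lambda>v. - (mletter \<star> ?A) v)) w"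
    unfolding mconv_weight[of weight, OF weight_append] weight_T_mould weight_antipode_T ..
  also have "\<dots> = 0" by (simp add: mconv_uminus_right mconv_assoc)
  finally show "(?T \<star> ?A) w = munit w"
    using weight_nonzero[of w] by (cases "w = []") (auto simp: munit_def T_mould_Nil)
qed

text \<open>All shuffles of \<open>a\<close> and \<open>b\<close> have the same weight. Multiplying
  by it removes the last letter of each shuffle, and induction on the total length applies to what
  remains; the nonzero weight is then cancelled.\<close>

lemma T_mould_symmetral: "shuffle_sum T_mould a b = T_mould a * T_mould b"
proof (induction "length a + length b" arbitrary: a b rule: less_induct)
  case less
  show ?case
  proof (cases a rule: rev_cases)
    case a: (snoc a' x)
    show ?thesis
    proof (cases b rule: rev_cases)
      case b: (snoc b' y)
      let ?d = "weight a + weight b"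
      have "a @ b \<noteq> []" using a by simp
      from weight_nonzero[OF this] have d: "?d \<noteq> 0" by (simp only: weight_append not_False_eq_True)
      have "?d * shuffle_sum T_mould a b
        = shuffle_sum (\<lambda>w. ?d * T_mould (w @ [x])) a' b + shuffle_sum (\<lambda>w. ?d * T_mould (w @ [y])) a b'"
        unfolding a b shuffle_sum_snoc by (simp add: shuffle_sum_def sum_distrib_left distrib_left)
      also have "shuffle_sum (\<lambda>w. ?d * T_mould (w @ [x])) a' b = shuffle_sum T_mould a' b"
        unfolding shuffle_sum_def
      proof (rule sum.cong)
        fix p assume "p \<in> tagged_shuffles a' b"
        then have "?d = weight (untag p @ [x])"
          using weight_untag[of p] by (simp add: tagged_shuffles_def a weight_append)
        then show "?d * T_mould (untag p @ [x]) = T_mould (untag p)"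
          by (simp only: T_mould_snoc)
      qed simp
      also have "shuffle_sum (\<lambda>w. ?d * T_mould (w @ [y])) a b' = shuffle_sum T_mould a b'"
        unfolding shuffle_sum_def
      proof (rule sum.cong)
        fix p assume "p \<in> tagged_shuffles a b'"
        then have "?d = weight (untag p @ [y])"
          using weight_untag[of p] by (simp add: tagged_shuffles_def b weight_append)
        then show "?d * T_mould (untag p @ [y]) = T_mould (untag p)"
          by (simp only: T_mould_snoc)
      qed simp
      also have "shuffle_sum T_mould a' b = T_mould a' * T_mould b"
        by (rule less) (simp add: a)
      also have "shuffle_sum T_mould a b' = T_mould a * T_mould b'"
        by (rule less) (simp add: b)
      also have "T_mould a' = weight a * T_mould a" by (simp only: a T_mould_snoc)
      also have "T_mould b' = weight b * T_mould b" by (simp only: b T_mould_snoc)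
      finally have "?d * shuffle_sum T_mould a b = ?d * (T_mould a * T_mould b)"
        by (simp add: algebra_simps)
      then show ?thesis using d by simp
    qed (simp add: T_mould_Nil)
  qed (simp add: T_mould_Nil)
qed

section \<open>The Birkhoff factors of T\<close>

definition U_minus :: mould where "U_minus = birkhoff_minus T_mould"
definition U_plus :: mould where "U_plus = U_minus \<star> T_mould"

text \<open>The factors are defined on all complex words, so they serve every alphabet
  \<open>A\<close>; uniqueness later identifies them with any given decomposition.\<close>

lemma birkhoff_U: "birkhoff_decomposition A T_mould U_minus U_plus"
  using birkhoff_decomposition_exists[of T_mould A, OF T_mould_Nil]
  by (simp add: U_minus_def U_plus_def mould_mult_eq_mconv)

lemma U_Nil [simp]: "U_minus [] = 1" "U_plus [] = 1"
  and U_minus_in: "w \<noteq> [] \<Longrightarrow> U_minus w \<in> K_minus"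
  using birkhoff_U[of UNIV] by (auto simp: birkhoff_decomposition_def)

lemma U_plus_in: "U_plus w \<in> K_plus"
proof (cases "w = []")
  case True then show ?thesis by (simp add: K_plus_iff)
next
  case False then show ?thesis using birkhoff_U[of UNIV] by (auto simp: birkhoff_decomposition_def)
qed

lemma U_minus_nth: "n \<ge> 0 \<Longrightarrow> U_minus w $$ n = (if w = [] \<and> n = 0 then 1 else 0)"
  using U_minus_in[of w] by (cases "w = []") (auto simp: K_minus_def)

lemma antipode_U_minus_in: "w \<noteq> [] \<Longrightarrow> mantipode U_minus w \<in> K_minus"
  using U_minus_in[of "rev w"] by (cases "even (length w)") (auto simp: mantipode_def K_minus_uminus)

text \<open>Expand the defect of symmetrality of \<open>U_plus\<close> over cuts of both words. By
  induction the terms with shorter prefixes cancel, so \<open>U_plus\<close> and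
  \<open>U_minus\<close> have the same defect. For nonempty words it lies in both
  \<open>K_plus\<close> and \<open>K_minus\<close>, hence vanishes.\<close>

lemma U_minus_symmetral: "shuffle_sum U_minus a b = U_minus a * U_minus b"
  and U_plus_symmetral: "shuffle_sum U_plus a b = U_plus a * U_plus b"
proof -
  have S: "shuffle_sum U_plus a b = (\<Sum>(j, k)\<in>{..length a} \<times> {..length b}.
      shuffle_sum U_minus (take j a) (take k b) * (T_mould (drop j a) * T_mould (drop k b)))" for a b
    by (simp add: U_plus_def shuffle_sum_mconv T_mould_symmetral sum.cartesian_product)
  have P: "U_plus a * U_plus b = (\<Sum>(j, k)\<in>{..length a} \<times> {..length b}.
      U_minus (take j a) * U_minus (take k b) * (T_mould (drop j a) * T_mould (drop k b)))" for a b
    by (simp add: U_plus_def mconv_def sum_product sum.cartesian_product mult_ac)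
  have *: "shuffle_sum U_minus a b = U_minus a * U_minus b" for a b
  proof (induction "length a + length b" arbitrary: a b rule: less_induct)
    case less
    show ?case
    proof (cases "a = [] \<or> b = []")
      case False
      let ?I = "{..length a} \<times> {..length b}"
      let ?d = "\<lambda>(j, k). (shuffle_sum U_minus (take j a) (take k b) - U_minus (take j a) * U_minus (take k b))
          * (T_mould (drop j a) * T_mould (drop k b))"
      have "shuffle_sum U_plus a b - U_plus a * U_plus b = sum ?d ?I"
        unfolding S P by (simp add: case_prod_unfold left_diff_distrib sum_subtractf)
      \<comment> \<open>Only this pair of cuts keeps both words whole; every other one has prefixes
        of smaller total length.\<close>
      also have "\<dots> = ?d (length a, length b) + sum ?d (?I - {(length a, length b)})"
        by (rule sum.remove) auto
      also have "sum ?d (?I - {(length a, length b)}) = 0"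
      proof (rule sum.neutral, rule ballI)
        fix z assume z: "z \<in> ?I - {(length a, length b)}"
        obtain j k where jk: "z = (j, k)" by (cases z)
        have "shuffle_sum U_minus (take j a) (take k b) = U_minus (take j a) * U_minus (take k b)"
          by (rule less) (use z jk in auto)
        then show "?d z = 0" by (simp add: jk)
      qed
      finally have eq: "shuffle_sum U_minus a b - U_minus a * U_minus b
          = shuffle_sum U_plus a b - U_plus a * U_plus b"
        by (simp add: T_mould_Nil)
      have "shuffle_sum U_minus a b \<in> K_minus"
        unfolding shuffle_sum_def
      proof (intro K_minus_sum U_minus_in)
        fix p assume "p \<in> tagged_shuffles a b"
        then show "untag p \<noteq> []" using False by (auto simp: tagged_shuffles_def untag_def)
      qed
      then have "shuffle_sum U_minus a b - U_minus a * U_minus b \<in> K_minus"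
        using False by (intro K_minus_diff K_minus_mult U_minus_in) auto
      moreover have "shuffle_sum U_plus a b \<in> K_plus"
        unfolding shuffle_sum_def by (intro K_plus_sum U_plus_in)
      then have "shuffle_sum U_plus a b - U_plus a * U_plus b \<in> K_plus"
        by (intro K_plus_diff K_plus_mult U_plus_in)
      ultimately show ?thesis using eq K_plus_minus by fastforce
    qed auto
  qed
  show "shuffle_sum U_minus a b = U_minus a * U_minus b" by (rule *)
  show "shuffle_sum U_plus a b = U_plus a * U_plus b"
    unfolding S P * ..
qed

text \<open>Inserting T times its antipode in the middle turns the product for
  \<open>U_minus\<close> into the one for \<open>U_plus\<close>. On nonempty words the first lies in
  \<open>K_minus\<close> and the second in \<open>K_plus\<close>.\<close>

lemma U_minus_antipode_right: "U_minus \<star> mantipode U_minus = munit"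
proof
  fix w
  have "U_minus \<star> mantipode U_minus = U_minus \<star> (T_mould \<star> mantipode T_mould) \<star> mantipode U_minus"
    by (simp add: T_mould_antipode)
  also have "\<dots> = U_plus \<star> mantipode U_plus"
    by (simp add: U_plus_def mantipode_mconv mconv_assoc)
  finally have eq: "U_minus \<star> mantipode U_minus = U_plus \<star> mantipode U_plus" .
  show "(U_minus \<star> mantipode U_minus) w = munit w"
  proof (cases "w = []")
    case False
    have "mantipode U_plus v \<in> K_plus" for v
      using U_plus_in[of "rev v"] by (cases "even (length v)") (auto simp: mantipode_def K_plus_iff)
    then have "(U_plus \<star> mantipode U_plus) w \<in> K_plus"
      unfolding mconv_def by (intro K_plus_sum K_plus_mult U_plus_in)
    moreover have "(U_minus \<star> mantipode U_minus) w \<in> K_minus"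
      unfolding mconv_def
    proof (rule K_minus_sum)
      fix i assume "i \<in> {..length w}"
      then consider "i = 0" | "i = length w" | "take i w \<noteq> []" "drop i w \<noteq> []"
        using False by fastforce
      then show "U_minus (take i w) * mantipode U_minus (drop i w) \<in> K_minus"
        by cases (use False in \<open>auto intro!: K_minus_mult U_minus_in antipode_U_minus_in\<close>)
    qed
    ultimately show ?thesis unfolding eq using False K_plus_minus by (auto simp: munit_def)
  qed simp
qed

lemma U_minus_antipode_left: "mantipode U_minus \<star> U_minus = munit"
  by (rule mconv_inverse_commute[OF U_minus_antipode_right]) simp_all

lemma U_plus_antipode_right: "U_plus \<star> mantipode U_plus = munit"
proof -
  have "U_plus \<star> mantipode U_plus = U_minus \<star> (T_mould \<star> mantipode T_mould) \<star> mantipode U_minus"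
    by (simp add: U_plus_def mantipode_mconv mconv_assoc)
  then show ?thesis by (simp add: T_mould_antipode U_minus_antipode_right)
qed

section \<open>The moulds N and S\<close>

definition N_coef :: "complex list \<Rightarrow> complex" where "N_coef w = - U_minus w $$ -1"
definition S_coef :: "complex list \<Rightarrow> complex" where "S_coef w = U_plus w $$ 0"
text \<open>The coefficients of the normal form in plain products of letters: the length is what
  expanding nested brackets of an alternal mould contributes.\<close>

definition F_coef :: "complex list \<Rightarrow> complex" where "F_coef w = of_nat (length w) * N_coef w"

lemma coef_Nil [simp]: "N_coef [] = 0" "S_coef [] = 1" "F_coef [] = 0"
  by (simp_all add: N_coef_def S_coef_def F_coef_def)

text \<open>Taking the constant term is multiplicative on \<open>K_plus\<close>.\<close>

lemma S_coef_symmetral: "shuffle_sum S_coef a b = S_coef a * S_coef b"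
proof -
  have "shuffle_sum S_coef a b = shuffle_sum U_plus a b $$ 0"
    by (simp add: shuffle_sum_def S_coef_def fls_nth_sum)
  then show ?thesis by (simp add: U_plus_symmetral S_coef_def K_plus_mult_nth0 U_plus_in)
qed

text \<open>For nonempty words the shuffle sum of \<open>U_minus\<close> is a product of two
  elements of \<open>K_minus\<close>, which has no residue.\<close>

lemma N_coef_alternal:
  assumes "a \<noteq> []" "b \<noteq> []" shows "shuffle_sum N_coef a b = 0"
proof -
  have "shuffle_sum N_coef a b = - (shuffle_sum U_minus a b $$ -1)"
    by (simp add: shuffle_sum_def N_coef_def fls_nth_sum sum_negf)
  then show ?thesis using assms by (simp add: U_minus_symmetral K_minus_mult_nth U_minus_in)
qed

lemma S_coef_antipode_right: "S_coef \<star> mantipode S_coef = munit"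
proof
  fix w
  have A: "mantipode U_plus v \<in> K_plus" "mantipode U_plus v $$ 0 = mantipode S_coef v" for v
    using U_plus_in[of "rev v"]
    by (cases "even (length v)"; auto simp: mantipode_def K_plus_iff S_coef_def)+
  have "(S_coef \<star> mantipode S_coef) w = (U_plus \<star> mantipode U_plus) w $$ 0"
    by (simp add: mconv_def fls_nth_sum K_plus_mult_nth0 U_plus_in A S_coef_def)
  then show "(S_coef \<star> mantipode S_coef) w = munit w"
    by (simp add: U_plus_antipode_right munit_def)
qed

lemma S_coef_antipode_left: "mantipode S_coef \<star> S_coef = munit"
  by (rule mconv_inverse_commute[OF S_coef_antipode_right]) simp_all

text \<open>Take the residue of \<open>U_minus \<star> mantipode U_minus = munit\<close>. Proper
  cuts give products inside \<open>K_minus\<close> without residue, so only the two trivial cuts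
  remain.\<close>

lemma mantipode_N_coef: "mantipode N_coef w = - N_coef w"
proof (cases "w = []")
  case False
  have "(U_minus \<star> mantipode U_minus) w $$ -1
      = (\<Sum>i\<le>length w. (U_minus (take i w) * mantipode U_minus (drop i w)) $$ -1)"
    by (simp add: mconv_def fls_nth_sum)
  also have "\<dots> = (\<Sum>i\<le>length w. (if i = 0 then mantipode U_minus w $$ -1 else 0) +
      (if i = length w then U_minus w $$ -1 else 0))"
  proof (rule sum.cong)
    fix i assume "i \<in> {..length w}"
    then consider "i = 0" | "i = length w" | "i > 0" "i < length w" "take i w \<noteq> []" "drop i w \<noteq> []"
      using False by fastforce
    then show "(U_minus (take i w) * mantipode U_minus (drop i w)) $$ -1
      = (if i = 0 then mantipode U_minus w $$ -1 else 0) + (if i = length w then U_minus w $$ -1 else 0)"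
      by cases (use False in \<open>auto simp: K_minus_mult_nth U_minus_in antipode_U_minus_in\<close>)
  qed simp
  also have "\<dots> = mantipode U_minus w $$ -1 + U_minus w $$ -1"
    by (simp add: sum.distrib)
  finally have "mantipode U_minus w $$ -1 = - (U_minus w $$ -1)"
    using False by (simp add: U_minus_antipode_right munit_def eq_neg_iff_add_eq_0)
  moreover have "mantipode U_minus w $$ -1 = - mantipode N_coef w"
    by (cases "even (length w)") (auto simp: mantipode_def N_coef_def)
  ultimately show ?thesis by (simp add: N_coef_def)
qed simp

lemma mantipode_F_coef: "mantipode F_coef w = - F_coef w"
proof -
  have "mantipode F_coef w = of_nat (length w) * mantipode N_coef w"
    by (simp add: F_coef_def mantipode_def)
  then show ?thesis by (simp add: mantipode_N_coef F_coef_def)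
qed

text \<open>Both sides of \<open>DU\<^sub>- \<star> U\<^sub>-\<^sup>-\<^sup>1 = (DU\<^sub>+ - U\<^sub>+ \<star> I) \<star> U\<^sub>+\<^sup>-\<^sup>1\<close> are independent of
  \<open>\<epsilon>\<close>: the left one has no positive powers and the right one no negative powers.\<close>

lemma weight_U_minus: "weight w * U_minus w = - ((\<lambda>v. fls_const (F_coef v)) \<star> U_minus) w"
  and weight_U_plus:
    "weight w * U_plus w = (U_plus \<star> mletter) w - ((\<lambda>v. fls_const (F_coef v)) \<star> U_plus) w"
proof -
  define DU where "DU = (\<lambda>w. weight w * U_minus w)"
  define DP where "DP = (\<lambda>w. weight w * U_plus w)"
  define G where "G = DU \<star> mantipode U_minus"
  \<comment> \<open>Leibniz rule for \<open>U_plus = U_minus \<star> T_mould\<close>, with the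
    differential equation of T in the second term.\<close>
  have DP: "DP w = (DU \<star> T_mould) w + (U_plus \<star> mletter) w" for w
    unfolding DP_def DU_def U_plus_def mconv_weight[of weight, OF weight_append] weight_T_mould
    by (simp add: mconv_assoc)
  have GU: "G \<star> U_minus = DU"
    by (simp add: G_def mconv_assoc U_minus_antipode_left)
  then have GP: "G \<star> U_plus = DU \<star> T_mould"
    by (simp add: U_plus_def flip: mconv_assoc)
  then have "G = DU \<star> T_mould \<star> mantipode U_plus"
    by (metis U_plus_antipode_right mconv_assoc mconv_munit_right)
  also have "DU \<star> T_mould = (\<lambda>w. DP w - (U_plus \<star> mletter) w)"
    using DP by (intro ext) (simp add: algebra_simps)
  finally have G2: "G = (\<lambda>w. DP w - (U_plus \<star> mletter) w) \<star> mantipode U_plus" .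
  have G_neg: "G w $$ n = 0" if "n < 0" for w n
  proof -
    have "mantipode U_plus v \<in> K_plus" for v
      using U_plus_in[of "rev v"] by (cases "even (length v)") (auto simp: mantipode_def K_plus_iff)
    moreover have "weight v \<in> K_plus" for v
      by (auto simp: K_plus_iff weight_def)
    moreover have "mletter v \<in> K_plus" for v :: "complex list"
      by (auto simp: K_plus_iff mletter_def)
    ultimately have "G w \<in> K_plus"
      unfolding G2 DP_def mconv_def
      by (intro K_plus_sum K_plus_mult K_plus_diff U_plus_in)
    then show ?thesis using that by (simp add: K_plus_iff)
  qed
  have G_pos: "G w $$ n = 0" if "n > 0" for w n
  proof -
    \<comment> \<open>The weight has degree at most one in \<open>\<epsilon>\<close> and kills the
      empty word; on the other words \<open>U_minus\<close> has only negative powers.\<close>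
    have "DU v $$ i = 0" if "i > 0" for v i
      using that by (cases "v = []") (simp_all add: DU_def weight_mult_nth U_minus_nth)
    moreover have "mantipode U_minus v $$ i = 0" if "i > 0" for v i
      using that antipode_U_minus_in[of v] by (cases "v = []") (auto simp: K_minus_def)
    ultimately show ?thesis using that
      unfolding G_def mconv_def fls_nth_sum
      by (intro sum.neutral ballI fls_times_nth_above[of 0 _ 0]) auto
  qed
  have Gc: "G w = fls_const (G w $$ 0)" for w
    using G_neg G_pos by (auto simp: fls_eq_iff) (metis linorder_neqE)
  \<comment> \<open>Compare constant terms in \<open>G \<star> U_minus = DU\<close>. Since
    \<open>G\<close> is constant in \<open>\<epsilon>\<close>, only the empty suffix contributes on
    the left; on the right the weight lifts the residue to the constant term, multiplied by the
    length.\<close>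
  have "G w $$ 0 = - F_coef w" for w
  proof -
    have "DU w $$ 0 = (\<Sum>i\<le>length w. (G (take i w) * U_minus (drop i w)) $$ 0)"
      unfolding GU[symmetric] mconv_def fls_nth_sum ..
    also have "\<dots> = (\<Sum>i\<le>length w. if i = length w then G w $$ 0 else 0)"
      by (rule sum.cong, simp, subst Gc) (auto simp: U_minus_nth)
    also have "\<dots> = G w $$ 0" by simp
    finally show ?thesis
      by (cases "w = []") (simp_all add: DU_def weight_mult_nth U_minus_nth F_coef_def N_coef_def)
  qed
  then have G: "G = (\<lambda>v. - fls_const (F_coef v))"
    using Gc by (metis fls_const_uminus)
  show "weight w * U_minus w = - ((\<lambda>v. fls_const (F_coef v)) \<star> U_minus) w"
    using GU G by (metis DU_def mconv_uminus_left)
  show "weight w * U_plus w = (U_plus \<star> mletter) w - ((\<lambda>v. fls_const (F_coef v)) \<star> U_plus) w"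
    using DP[of w] GP G by (simp add: DP_def mconv_uminus_left flip: GP)
qed

text \<open>The constant term of \<open>weight_U_plus\<close>. The \<open>\<epsilon>\<close> part of
  the weight would need a coefficient of \<open>U_plus\<close> at the power -1, which is
  zero.\<close>

lemma F_S_coef: "(F_coef \<star> S_coef) w = (S_coef \<star> mletter) w - sum_list w * S_coef w"
proof -
  have "(weight w * U_plus w) $$ 0 = sum_list w * S_coef w"
    using U_plus_in[of w] by (simp add: weight_mult_nth K_plus_iff S_coef_def)
  moreover have "(U_plus \<star> mletter) w $$ 0 = (S_coef \<star> mletter) w"
    by (cases w rule: rev_cases) (simp_all add: mconv_mletter_snoc S_coef_def)
  moreover have "((\<lambda>v. fls_const (F_coef v)) \<star> U_plus) w $$ 0 = (F_coef \<star> S_coef) w"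
    by (simp add: mconv_def fls_nth_sum S_coef_def)
  ultimately show ?thesis
    using arg_cong[OF weight_U_plus[of w], of "\<lambda>f. f $$ 0"] by (simp add: algebra_simps)
qed

text \<open>In the recursion for \<open>U_minus\<close>, a proper prefix is either empty or
  nonresonant, so \<open>F_coef\<close> vanishes there, or resonant, so that the suffix is
  nonresonant and shorter. Hence the weight times \<open>U_minus w\<close> is a constant. A nonzero
  \<open>U_minus w\<close> would contradict this at its lowest power, which is negative and gets
  multiplied by the nonzero letter sum.\<close>

lemma U_minus_resonant: "sum_list w \<noteq> 0 \<Longrightarrow> U_minus w = 0"
proof (induction "length w" arbitrary: w rule: less_induct)
  case less
  have "((\<lambda>v. fls_const (F_coef v)) \<star> U_minus) w
      = (\<Sum>i\<le>length w. if i = length w then fls_const (F_coef w) else 0)"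
    unfolding mconv_def
  proof (rule sum.cong)
    fix i assume i: "i \<in> {..length w}"
    have "fls_const (F_coef (take i w)) * U_minus (drop i w) = 0" if "i < length w"
    proof (cases "i = 0 \<or> sum_list (take i w) \<noteq> 0")
      case True
      then have "F_coef (take i w) = 0"
        using that less.hyps[of "take i w"] by (auto simp: F_coef_def N_coef_def)
      then show ?thesis by simp
    next
      case False
      then have "sum_list (drop i w) \<noteq> 0"
        using less.prems by (metis add_0 append_take_drop_id sum_list_append)
      moreover have "length (drop i w) < length w" using that False by (cases "i = 0") auto
      ultimately show ?thesis by (simp add: less.hyps)
    qed
    then show "fls_const (F_coef (take i w)) * U_minus (drop i w)
      = (if i = length w then fls_const (F_coef w) else 0)" using i by auto
  qed simp
  then have eq: "weight w * U_minus w = - fls_const (F_coef w)"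
    using weight_U_minus[of w] by simp
  show ?case
  proof (rule ccontr)
    let ?n = "fls_subdegree (U_minus w)"
    assume nz: "U_minus w \<noteq> 0"
    have "w \<noteq> []" using less.prems by auto
    then have "?n < 0"
      using nth_fls_subdegree_nonzero[OF nz] U_minus_nth[of ?n w] by force
    then have "(weight w * U_minus w) $$ ?n = 0" by (simp add: eq)
    then show False
      using nth_fls_subdegree_nonzero[OF nz] less.prems by (simp add: weight_mult_nth)
  qed
qed

lemma F_coef_resonant: "sum_list w * F_coef w = 0"
  using U_minus_resonant[of w] by (auto simp: F_coef_def N_coef_def)

section \<open>Complex conjugation of moulds, with \<open>\<epsilon>\<close> treated as real\<close>

definition fls_cnj :: "complex fls \<Rightarrow> complex fls" where
  "fls_cnj f = Abs_fls (\<lambda>n. cnj (f $$ n))"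

lemma fls_cnj_nth [simp]: "fls_cnj f $$ n = cnj (f $$ n)"
  unfolding fls_cnj_def by (rule nth_Abs_fls_lower_bound[of "fls_subdegree f"]) simp

lemma fls_cnj_simps: "fls_cnj 0 = 0" "fls_cnj 1 = 1" "fls_cnj (f + g) = fls_cnj f + fls_cnj g"
  "fls_cnj (- f) = - fls_cnj f" "fls_cnj (fls_const c) = fls_const (cnj c)"
  "fls_cnj (sum h I) = (\<Sum>i\<in>I. fls_cnj (h i))"
  by (auto simp: fls_eq_iff fls_nth_sum)

lemma fls_cnj_mult: "fls_cnj (f * g) = fls_cnj f * fls_cnj g"
proof -
  \<comment> \<open>Equal subdegrees make the finite sums for the coefficients of the two products
    run over the same range.\<close>
  have "fls_subdegree (fls_cnj f) = fls_subdegree f" for f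
    by (cases "f = 0") (auto intro!: fls_subdegree_eqI simp: fls_cnj_simps)
  then show ?thesis by (simp add: fls_eq_iff fls_times_nth(2))
qed

lemma fls_cnj_weight: "fls_cnj (weight (map cnj w)) = weight w"
proof -
  have "cnj (sum_list (map cnj w)) = sum_list w" by (induction w) auto
  then show ?thesis by (auto simp: weight_def fls_eq_iff fls_of_nat)
qed

lemma fls_cnj_T_mould: "fls_cnj (T_mould (map cnj w)) = T_mould w"
proof (induction w rule: rev_induct)
  case (snoc x w)
  have "fls_cnj (weight (map cnj (w @ [x])) * T_mould (map cnj (w @ [x]))) = fls_cnj (T_mould (map cnj w))"
    using T_mould_snoc[of "map cnj w" "cnj x"] by simp
  then have "weight (w @ [x]) * fls_cnj (T_mould (map cnj (w @ [x]))) = T_mould w"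
    by (simp only: fls_cnj_mult fls_cnj_weight snoc)
  also have "\<dots> = weight (w @ [x]) * T_mould (w @ [x])" by (simp only: T_mould_snoc)
  finally show ?case using weight_nonzero[of "w @ [x]"] by simp
qed (simp add: T_mould_Nil fls_cnj_simps)

text \<open>Conjugating letters and values fixes T, because its formula has real coefficients, and
  preserves \<open>K_plus\<close> and \<open>K_minus\<close>. The conjugated factors therefore
  decompose T again, and uniqueness applies.\<close>

lemma fls_cnj_U: "fls_cnj (U_minus (map cnj w)) = U_minus w \<and> fls_cnj (U_plus (map cnj w)) = U_plus w"
proof -
  let ?c = "\<lambda>M w. fls_cnj (M (map cnj w))"
  have "birkhoff_decomposition UNIV T_mould (?c U_minus) (?c U_plus)"
    unfolding birkhoff_decomposition_def mould_mult_eq_mconv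
  proof (intro conjI ballI impI)
    fix w :: "complex list" assume w: "w \<noteq> []"
    show "?c U_minus w \<in> K_minus" "?c U_plus w \<in> K_plus"
      using w U_minus_in[of "map cnj w"] U_plus_in[of "map cnj w"] by (auto simp: K_minus_def K_plus_iff)
  next
    fix w :: "complex list"
    have "?c U_plus w = (\<Sum>i\<le>length w. ?c U_minus (take i w) * ?c T_mould (drop i w))"
      by (simp add: U_plus_def mconv_def fls_cnj_simps fls_cnj_mult take_map drop_map)
    then show "(?c U_minus \<star> T_mould) w = ?c U_plus w"
      by (simp add: fls_cnj_T_mould mconv_def)
  qed (simp_all add: fls_cnj_simps)
  from birkhoff_decomposition_unique[OF T_mould_Nil this birkhoff_U, of w] show ?thesis by simp
qed

lemma cnj_S_coef: "cnj (S_coef (map cnj w)) = S_coef w"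
  using arg_cong[OF conjunct2[OF fls_cnj_U[of w]], of "\<lambda>f. f $$ 0"] by (simp add: S_coef_def)

lemma cnj_F_coef: "cnj (F_coef (map cnj w)) = F_coef w"
  using arg_cong[OF conjunct1[OF fls_cnj_U[of w]], of "\<lambda>f. f $$ -1"]
  by (simp add: F_coef_def N_coef_def)


no_notation fls_nth (infixl "$$" 75)

section \<open>Formal series of operators\<close>

lemma sum_fun_apply: "(\<Sum>i\<in>I. f i) x = (\<Sum>i\<in>I. f i x)"
  by (induction I rule: infinite_finite_induct) (auto simp: plus_fun_def zero_fun_def)

lemma op_mult_nth: "fps_nth (A \<odot> B) n x = (\<Sum>i\<le>n. fps_nth A i (fps_nth B (n - i) x))"
  by (simp add: op_mult_def sum_fun_apply)

lemma op_scale_nth: "fps_nth (op_scale c A) n x = c *\<^sub>C fps_nth A n x"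
  by (simp add: op_scale_def)

lemma op_add_nth: "fps_nth (A + B :: 'h::complex_inner opfps) n x = fps_nth A n x + fps_nth B n x"
  by (simp add: plus_fun_def)

lemma op_diff_nth: "fps_nth (A - B :: 'h::complex_inner opfps) n x = fps_nth A n x - fps_nth B n x"
  by (simp add: fun_diff_def)

lemma op_zero_nth: "fps_nth (0 :: 'h::complex_inner opfps) n x = 0"
  by (simp add: zero_fun_def)

lemma op_sum_nth: "fps_nth (\<Sum>i\<in>I. F i :: 'h::complex_inner opfps) n x = (\<Sum>i\<in>I. fps_nth (F i) n x)"
  by (simp add: fps_sum_nth sum_fun_apply)

lemmas op_nth = op_mult_nth op_scale_nth op_add_nth op_diff_nth op_zero_nth op_sum_nth

lemma op_eqI: "(\<And>n x. fps_nth A n x = fps_nth B n x) \<Longrightarrow> A = (B :: 'h::complex_inner opfps)"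
  by (simp add: fps_eq_iff fun_eq_iff)

text \<open>On the left, distributivity is pointwise addition of functions; its counterpart on the
  right rests on linearity and is stated for \<open>LC V\<close> below.\<close>

lemma op_mult_add_left: "(A + A') \<odot> B = A \<odot> B + A' \<odot> B"
  by (rule op_eqI) (simp add: op_nth sum.distrib)

lemma op_mult_diff_left: "(A - A') \<odot> B = A \<odot> B - A' \<odot> B"
  by (rule op_eqI) (simp add: op_nth sum_subtractf)

lemma op_mult_scale_left: "op_scale c A \<odot> B = op_scale c (A \<odot> B)"
  by (rule op_eqI) (simp add: op_nth complex_vector.scale_sum_right)

lemma op_scale_simps [simp]: "op_scale 1 A = A" "op_scale 0 A = 0" "op_scale c 0 = 0"
  "op_scale c (op_scale d A) = op_scale (c * d) A"
  by (auto intro!: op_eqI simp: op_nth)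

lemma op_scale_distribs: "op_scale c (A + B) = op_scale c A + op_scale c B"
  "op_scale c (A - B) = op_scale c A - op_scale c B"
  "op_scale (c + d) A = op_scale c A + op_scale d A"
  "op_scale (c - d) A = op_scale c A - op_scale d A"
  by (auto intro!: op_eqI simp: op_nth complex_vector.scale_right_distrib
    complex_vector.scale_right_diff_distrib complex_vector.scale_left_distrib
    complex_vector.scale_left_diff_distrib)

lemma op_scale_sum: "op_scale c (\<Sum>i\<in>I. F i) = (\<Sum>i\<in>I. op_scale c (F i))"
  by (rule op_eqI) (simp add: op_nth complex_vector.scale_sum_right)

lemma op_scale_sum_left: "op_scale (\<Sum>i\<in>I. c i) A = (\<Sum>i\<in>I. op_scale (c i) A)"
  by (rule op_eqI) (simp add: op_nth complex_vector.scale_sum_left)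

lemma cinner_add_left: "cinner (x + y) z = cinner x z + cinner y z"
  using cinner_commute[of "x + y" z] cinner_commute[of x z] cinner_commute[of y z]
  by (simp add: cinner_add_right)

lemma cinner_scaleC_left: "cinner (c *\<^sub>C x) y = cnj c * cinner x y"
  using cinner_commute[of "c *\<^sub>C x" y] cinner_commute[of x y] by (simp add: cinner_scaleC_right)

lemma cinner_zero [simp]: "cinner x 0 = 0" "cinner 0 x = 0"
  using cinner_scaleC_right[of x 0 0] cinner_scaleC_left[of 0 0 x] by simp_all

lemma cinner_sum_right: "cinner x (\<Sum>i\<in>I. f i) = (\<Sum>i\<in>I. cinner x (f i))"
  by (induction I rule: infinite_finite_induct) (auto simp: cinner_add_right)

lemma cinner_sum_left: "cinner (\<Sum>i\<in>I. f i) x = (\<Sum>i\<in>I. cinner (f i) x)"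
  by (induction I rule: infinite_finite_induct) (auto simp: cinner_add_left)

section \<open>The algebra of operator series preserving a subspace\<close>

locale opalg =
  fixes V :: "'h::complex_inner set"
  assumes subspace: "complex_vector.subspace V"
begin

lemma V_closed [simp]: "0 \<in> V" "x \<in> V \<Longrightarrow> y \<in> V \<Longrightarrow> x + y \<in> V" "x \<in> V \<Longrightarrow> c *\<^sub>C x \<in> V"
  using subspace by (auto simp: complex_vector.subspace_def)

lemma V_diff [simp]: "x \<in> V \<Longrightarrow> y \<in> V \<Longrightarrow> x - y \<in> V"
  using subspace complex_vector.subspace_diff by blast

lemma V_sum: "(\<And>i. i \<in> I \<Longrightarrow> f i \<in> V) \<Longrightarrow> sum f I \<in> V"
  using subspace complex_vector.subspace_sum by blast

lemma LC_iff: "A \<in> LC V \<longleftrightarrow> (\<forall>n. (\<forall>x\<in>V. fps_nth A n x \<in> V) \<and>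
     (\<forall>x\<in>V. \<forall>y\<in>V. fps_nth A n (x + y) = fps_nth A n x + fps_nth A n y) \<and>
     (\<forall>c. \<forall>x\<in>V. fps_nth A n (c *\<^sub>C x) = c *\<^sub>C fps_nth A n x) \<and>
     (\<forall>x. x \<notin> V \<longrightarrow> fps_nth A n x = 0))"
  by (simp add: LC_def linops_def)

lemma LC_into: "A \<in> LC V \<Longrightarrow> x \<in> V \<Longrightarrow> fps_nth A n x \<in> V"
  and LC_add: "A \<in> LC V \<Longrightarrow> x \<in> V \<Longrightarrow> y \<in> V \<Longrightarrow> fps_nth A n (x + y) = fps_nth A n x + fps_nth A n y"
  and LC_scale: "A \<in> LC V \<Longrightarrow> x \<in> V \<Longrightarrow> fps_nth A n (c *\<^sub>C x) = c *\<^sub>C fps_nth A n x"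
  and LC_outside: "A \<in> LC V \<Longrightarrow> x \<notin> V \<Longrightarrow> fps_nth A n x = 0"
  by (simp_all add: LC_iff)

lemma LC_at_0 [simp]: "A \<in> LC V \<Longrightarrow> fps_nth A n 0 = 0"
  using LC_scale[of A 0 n 0] by simp

lemma LC_in_V: "A \<in> LC V \<Longrightarrow> fps_nth A n x \<in> V"
  using LC_into LC_outside V_closed(1) by metis

lemma LC_sum: "A \<in> LC V \<Longrightarrow> (\<And>i. i \<in> I \<Longrightarrow> f i \<in> V) \<Longrightarrow> fps_nth A n (\<Sum>i\<in>I. f i) = (\<Sum>i\<in>I. fps_nth A n (f i))"
proof (induction I rule: infinite_finite_induct)
  case (insert i I)
  then show ?case by (simp add: LC_add V_sum)
qed auto

lemma LC_eqI:
  assumes "A \<in> LC V" "B \<in> LC V" "\<And>n x. x \<in> V \<Longrightarrow> fps_nth A n x = fps_nth B n x"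
  shows "A = B"
  using assms LC_outside by (intro op_eqI) metis

lemma LC_zero [simp]: "0 \<in> LC V"
  by (simp add: LC_iff op_nth)

lemma LC_plus [simp]: "A \<in> LC V \<Longrightarrow> B \<in> LC V \<Longrightarrow> A + B \<in> LC V"
  by (simp add: LC_iff op_nth complex_vector.scale_right_distrib)

lemma LC_minus [simp]: "A \<in> LC V \<Longrightarrow> B \<in> LC V \<Longrightarrow> A - B \<in> LC V"
  by (simp add: LC_iff op_nth complex_vector.scale_right_diff_distrib)

lemma LC_op_scale [simp]: "A \<in> LC V \<Longrightarrow> op_scale c A \<in> LC V"
  by (simp add: LC_iff op_nth complex_vector.scale_right_distrib mult.commute)

lemma LC_sum_closed [simp]: "(\<And>i. i \<in> I \<Longrightarrow> F i \<in> LC V) \<Longrightarrow> sum F I \<in> LC V"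
  by (induction I rule: infinite_finite_induct) auto

lemma LC_mult [simp]: "A \<in> LC V \<Longrightarrow> B \<in> LC V \<Longrightarrow> A \<odot> B \<in> LC V"
  by (subst LC_iff)
    (simp add: op_nth V_sum LC_into LC_add LC_scale LC_outside sum.distrib complex_vector.scale_sum_right)

lemma LC_one [simp]: "op_one V \<in> LC V"
  by (simp add: LC_iff op_one_def restrict_op_def zero_fun_def)

lemma op_one_nth: "fps_nth (op_one V) n x = (if n = 0 \<and> x \<in> V then x else 0)"
  by (simp add: op_one_def restrict_op_def zero_fun_def)

lemma op_mult_one_left [simp]: "A \<in> LC V \<Longrightarrow> op_one V \<odot> A = A"
proof (rule op_eqI)
  fix n x assume A: "A \<in> LC V"
  have "fps_nth (op_one V \<odot> A) n x = (\<Sum>i\<le>n. if i = 0 then fps_nth A n x else 0)"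
    unfolding op_nth op_one_nth by (rule sum.cong) (auto simp: A LC_in_V)
  then show "fps_nth (op_one V \<odot> A) n x = fps_nth A n x" by simp
qed

lemma op_mult_one_right [simp]: "A \<in> LC V \<Longrightarrow> A \<odot> op_one V = A"
proof (rule op_eqI)
  fix n x assume A: "A \<in> LC V"
  have "fps_nth (A \<odot> op_one V) n x = (\<Sum>i\<le>n. if i = n then fps_nth A n x else 0)"
    unfolding op_nth op_one_nth by (rule sum.cong) (auto simp: A LC_outside)
  then show "fps_nth (A \<odot> op_one V) n x = fps_nth A n x" by simp
qed

lemma op_mult_assoc:
  assumes "A \<in> LC V" "B \<in> LC V" "C \<in> LC V"
  shows "A \<odot> B \<odot> C = A \<odot> (B \<odot> C)"
proof (rule op_eqI)
  fix n x
  have "fps_nth (A \<odot> B \<odot> C) n x = (\<Sum>j=0..n. \<Sum>i=0..j. fps_nth A i (fps_nth B (j - i) (fps_nth C (n - j) x)))"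
    by (simp add: op_nth atLeast0AtMost)
  \<comment> \<open>The re-indexing of the triple sum known from products of power series; linearity
    of \<open>A\<close> then pulls the inner sum inside.\<close>
  also have "\<dots> = (\<Sum>j=0..n. \<Sum>i=0..n - j. fps_nth A j (fps_nth B i (fps_nth C (n - j - i) x)))"
    by (rule fps_mult_assoc_lemma)
  also have "\<dots> = fps_nth (A \<odot> (B \<odot> C)) n x"
    by (simp add: op_nth atLeast0AtMost LC_sum[OF assms(1)] LC_in_V assms)
  finally show "fps_nth (A \<odot> B \<odot> C) n x = fps_nth (A \<odot> (B \<odot> C)) n x" .
qed

lemma op_mult_add_right: "A \<in> LC V \<Longrightarrow> B \<in> LC V \<Longrightarrow> C \<in> LC V \<Longrightarrow> A \<odot> (B + C) = A \<odot> B + A \<odot> C"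
  by (rule op_eqI) (simp add: op_nth LC_add LC_in_V sum.distrib)

lemma op_mult_scale_right: "A \<in> LC V \<Longrightarrow> B \<in> LC V \<Longrightarrow> A \<odot> op_scale c B = op_scale c (A \<odot> B)"
  by (rule op_eqI) (simp add: op_nth LC_scale LC_in_V complex_vector.scale_sum_right)

lemma op_mult_zero [simp]: "A \<in> LC V \<Longrightarrow> A \<odot> 0 = 0" "0 \<odot> A = 0"
  by (auto intro!: op_eqI simp: op_nth)

lemma op_mult_sum_right: "A \<in> LC V \<Longrightarrow> (\<And>i. i \<in> I \<Longrightarrow> F i \<in> LC V) \<Longrightarrow> A \<odot> (\<Sum>i\<in>I. F i) = (\<Sum>i\<in>I. A \<odot> F i)"
  by (induction I rule: infinite_finite_induct) (auto simp: op_mult_add_right)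

text \<open>Orders in \<open>\<mu>\<close> add under products.\<close>

lemma op_mult_order:
  assumes A: "A \<in> LC V" "\<And>m. m < p \<Longrightarrow> fps_nth A m = 0" and B: "\<And>m. m < q \<Longrightarrow> fps_nth B m = 0"
    and n: "n < p + q"
  shows "fps_nth (A \<odot> B) n = 0"
proof
  fix x
  have "fps_nth A i (fps_nth B (n - i) x) = 0" if "i \<le> n" for i
  proof (cases "i < p")
    case False
    then have "n - i < q" using n that by linarith
    then show ?thesis using A B by (simp add: zero_fun_def)
  qed (simp add: A zero_fun_def)
  then show "fps_nth (A \<odot> B) n x = 0 x" by (simp add: op_nth zero_fun_def)
qed

lemma LC_monoid: "monoid (LC_monoid V)"
  by (rule monoidI) (simp_all add: LC_monoid_def op_mult_assoc)

lemma op_inverse_eqI: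
  assumes "C \<in> LC V" "C' \<in> LC V" "C \<odot> C' = op_one V" "C' \<odot> C = op_one V"
  shows "C \<in> Units (LC_monoid V)" "op_inverse V C = C'"
proof -
  interpret monoid "LC_monoid V" by (rule LC_monoid)
  show "C \<in> Units (LC_monoid V)"
    using assms by (auto simp: Units_def LC_monoid_def)
  show "op_inverse V C = C'"
    unfolding op_inverse_def using assms by (intro inv_unique'[symmetric]) (auto simp: LC_monoid_def)
qed

section \<open>Locally finite sums\<close>

text \<open>Stronger than \<open>op_summable\<close> in form: finiteness is asked at every vector of
  \<open>V\<close>, because in a product the left factor meets images of basis vectors, and the
  terms must lie in \<open>LC V\<close>.\<close>

definition osummable :: "('i \<Rightarrow> 'h opfps) \<Rightarrow> 'i set \<Rightarrow> bool" where
  "osummable F I \<longleftrightarrow> (\<forall>i\<in>I. F i \<in> LC V) \<and> (\<forall>n. \<forall>x\<in>V. finite {i\<in>I. fps_nth (F i) n x \<noteq> 0})"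

definition has_osum :: "('i \<Rightarrow> 'h opfps) \<Rightarrow> 'i set \<Rightarrow> 'h opfps \<Rightarrow> bool" where
  "has_osum F I S \<longleftrightarrow> osummable F I \<and> S \<in> LC V \<and>
     (\<forall>n. \<forall>x\<in>V. fps_nth S n x = (\<Sum>i\<in>{i\<in>I. fps_nth (F i) n x \<noteq> 0}. fps_nth (F i) n x))"

lemma osummable_LC: "osummable F I \<Longrightarrow> i \<in> I \<Longrightarrow> F i \<in> LC V"
  and osummable_finite: "osummable F I \<Longrightarrow> x \<in> V \<Longrightarrow> finite {i\<in>I. fps_nth (F i) n x \<noteq> 0}"
  by (auto simp: osummable_def)

lemma has_osumD: "has_osum F I S \<Longrightarrow> osummable F I" "has_osum F I S \<Longrightarrow> S \<in> LC V"
  by (auto simp: has_osum_def)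

text \<open>Enlarging the support to any finite index set lets several sums be compared term by term
  over one set.\<close>

lemma has_osum_superset:
  assumes "has_osum F I S" "x \<in> V" "finite K" "K \<subseteq> I" "{i\<in>I. fps_nth (F i) n x \<noteq> 0} \<subseteq> K"
  shows "fps_nth S n x = (\<Sum>i\<in>K. fps_nth (F i) n x)"
proof -
  have "fps_nth S n x = (\<Sum>i\<in>{i\<in>I. fps_nth (F i) n x \<noteq> 0}. fps_nth (F i) n x)"
    using assms by (simp add: has_osum_def)
  also have "\<dots> = (\<Sum>i\<in>K. fps_nth (F i) n x)"
    using assms by (intro sum.mono_neutral_left) auto
  finally show ?thesis .
qed

lemma has_osumI:
  assumes "osummable F I" "S \<in> LC V"
    and "\<And>n x. x \<in> V \<Longrightarrow> \<exists>K. finite K \<and> K \<subseteq> I \<and> {i\<in>I. fps_nth (F i) n x \<noteq> 0} \<subseteq> K \<and>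
      fps_nth S n x = (\<Sum>i\<in>K. fps_nth (F i) n x)"
  shows "has_osum F I S"
  unfolding has_osum_def
proof (intro conjI assms allI ballI)
  fix n x assume "x \<in> V"
  from assms(3)[OF this, of n] obtain K where "finite K" "K \<subseteq> I" "{i\<in>I. fps_nth (F i) n x \<noteq> 0} \<subseteq> K"
    and *: "fps_nth S n x = (\<Sum>i\<in>K. fps_nth (F i) n x)" by blast
  then show "fps_nth S n x = (\<Sum>i\<in>{i\<in>I. fps_nth (F i) n x \<noteq> 0}. fps_nth (F i) n x)"
    unfolding * by (intro sum.mono_neutral_right) auto
qed

lemma has_osum_op_sum:
  assumes F: "osummable F I"
  shows "has_osum F I (op_sum V F I)"
proof -
  have eq: "fps_nth (op_sum V F I) n x = (\<Sum>i\<in>{i\<in>I. fps_nth (F i) n x \<noteq> 0}. fps_nth (F i) n x)"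
    if "x \<in> V" for n x
    using that by (simp add: op_sum_def restrict_op_def)
  have eqK: "fps_nth (op_sum V F I) n x = (\<Sum>i\<in>K. fps_nth (F i) n x)"
    if "x \<in> V" "finite K" "K \<subseteq> I" "{i\<in>I. fps_nth (F i) n x \<noteq> 0} \<subseteq> K" for n x K
    unfolding eq[OF that(1)] using that by (intro sum.mono_neutral_left) auto
  have "op_sum V F I \<in> LC V"
    unfolding LC_iff
  proof (intro allI conjI ballI impI)
    fix n x y assume xy: "x \<in> V" "y \<in> V"
    let ?K = "\<lambda>x. {i\<in>I. fps_nth (F i) n x \<noteq> 0}"
    \<comment> \<open>One finite index set containing the supports at all three vectors.\<close>
    let ?L = "?K x \<union> ?K y \<union> ?K (x + y)"
    have "finite ?L" "?L \<subseteq> I" using F xy by (auto simp: osummable_finite)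
    then show "fps_nth (op_sum V F I) n (x + y) = fps_nth (op_sum V F I) n x + fps_nth (op_sum V F I) n y"
      using xy F by (subst (1 2 3) eqK[of _ ?L])
        (auto simp: sum.distrib[symmetric] osummable_LC LC_add intro!: sum.cong)
  next
    fix n c x assume x: "x \<in> V"
    let ?K = "\<lambda>x. {i\<in>I. fps_nth (F i) n x \<noteq> 0}"
    let ?L = "?K x \<union> ?K (c *\<^sub>C x)"
    have "finite ?L" "?L \<subseteq> I" using F x by (auto simp: osummable_finite)
    then show "fps_nth (op_sum V F I) n (c *\<^sub>C x) = c *\<^sub>C fps_nth (op_sum V F I) n x"
      using x F by (subst (1 2) eqK[of _ ?L])
        (auto simp: complex_vector.scale_sum_right osummable_LC LC_scale intro!: sum.cong)
  next
    fix n x assume "x \<in> V"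
    then show "fps_nth (op_sum V F I) n x \<in> V"
      unfolding eq[OF \<open>x \<in> V\<close>] using osummable_LC[OF F] by (intro V_sum LC_in_V) auto
  next
    fix n x assume "x \<notin> V"
    then show "fps_nth (op_sum V F I) n x = 0" by (simp add: op_sum_def restrict_op_def)
  qed
  then show ?thesis using F eq by (simp add: has_osum_def)
qed

lemma has_osum_unique: "has_osum F I S \<Longrightarrow> has_osum F I S' \<Longrightarrow> S = S'"
  by (rule LC_eqI) (auto simp: has_osum_def)

lemma op_sum_eqI: "has_osum F I S \<Longrightarrow> op_sum V F I = S"
  using has_osum_unique has_osum_op_sum has_osumD(1) by blast

lemma has_osum_cong: "(\<And>i. i \<in> I \<Longrightarrow> F i = G i) \<Longrightarrow> has_osum F I S \<longleftrightarrow> has_osum G I S"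
proof -
  assume *: "\<And>i. i \<in> I \<Longrightarrow> F i = G i"
  then have "{i\<in>I. fps_nth (F i) n x \<noteq> 0} = {i\<in>I. fps_nth (G i) n x \<noteq> 0}" for n x by auto
  moreover from * have "(\<Sum>i\<in>{i\<in>I. fps_nth (G i) n x \<noteq> 0}. fps_nth (F i) n x)
      = (\<Sum>i\<in>{i\<in>I. fps_nth (G i) n x \<noteq> 0}. fps_nth (G i) n x)" for n x by (intro sum.cong) auto
  ultimately show ?thesis using * by (simp add: has_osum_def osummable_def)
qed

lemma has_osum_finite:
  assumes "finite I" "\<And>i. i \<in> I \<Longrightarrow> F i \<in> LC V"
  shows "has_osum F I (\<Sum>i\<in>I. F i)"
  by (rule has_osumI) (use assms in \<open>auto simp: osummable_def op_nth intro!: exI[of _ I]\<close>)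

text \<open>Pulling a summable family back along a map with finite fibres, up to scalars, keeps the
  supports finite.\<close>

lemma osummable_pull:
  assumes G: "osummable G K" and \<pi>: "\<And>i. i \<in> I \<Longrightarrow> \<pi> i \<in> K" "\<And>k. k \<in> K \<Longrightarrow> finite {i\<in>I. \<pi> i = k}"
    and F: "\<And>i. i \<in> I \<Longrightarrow> F i = op_scale (c i) (G (\<pi> i))"
  shows "osummable F I"
  unfolding osummable_def
proof (intro conjI ballI allI)
  fix i assume "i \<in> I" then show "F i \<in> LC V" using F \<pi> G by (auto simp: osummable_LC)
next
  fix n x assume x: "x \<in> V"
  have "{i\<in>I. fps_nth (F i) n x \<noteq> 0} \<subseteq> (\<Union>k\<in>{k\<in>K. fps_nth (G k) n x \<noteq> 0}. {i\<in>I. \<pi> i = k})"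
    using F \<pi> by (auto simp: op_nth)
  moreover have "finite \<dots>"
    using \<pi> x G by (intro finite_UN_I) (auto simp: osummable_finite)
  ultimately show "finite {i\<in>I. fps_nth (F i) n x \<noteq> 0}" by (rule finite_subset)
qed

text \<open>Summation by fibres, which may themselves be infinite: at a given order and vector the
  finite support meets only finitely many fibres.\<close>

lemma has_osum_group:
  assumes F: "has_osum F I S" and \<pi>: "\<And>i. i \<in> I \<Longrightarrow> \<pi> i \<in> K"
    and G: "\<And>k. k \<in> K \<Longrightarrow> has_osum F {i\<in>I. \<pi> i = k} (G k)"
  shows "has_osum G K S"
proof (rule has_osumI)
  let ?s = "\<lambda>n x. {i\<in>I. fps_nth (F i) n x \<noteq> 0}"
  have fin: "finite (?s n x)" if "x \<in> V" for n x
    using F that by (simp add: has_osumD osummable_finite)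
  have Gs: "fps_nth (G k) n x = (\<Sum>i\<in>{i\<in>?s n x. \<pi> i = k}. fps_nth (F i) n x)"
    if "k \<in> K" "x \<in> V" for k n x
  proof -
    have "{i\<in>{i\<in>I. \<pi> i = k}. fps_nth (F i) n x \<noteq> 0} = {i\<in>?s n x. \<pi> i = k}" by auto
    then show ?thesis using G[OF that(1)] that(2) unfolding has_osum_def by simp
  qed
  have sub: "{k\<in>K. fps_nth (G k) n x \<noteq> 0} \<subseteq> \<pi> ` ?s n x" if "x \<in> V" for n x
  proof
    fix k assume k: "k \<in> {k\<in>K. fps_nth (G k) n x \<noteq> 0}"
    have "{i\<in>?s n x. \<pi> i = k} \<noteq> {}"
    proof
      assume E: "{i\<in>?s n x. \<pi> i = k} = {}"
      have "k \<in> K" using k by simp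
      from Gs[OF this that, of n] have "fps_nth (G k) n x = 0" unfolding E by simp
      then show False using k by simp
    qed
    then show "k \<in> \<pi> ` ?s n x" by auto
  qed
  show "osummable G K"
    unfolding osummable_def
  proof (intro conjI ballI allI)
    fix k assume "k \<in> K" then show "G k \<in> LC V" using G has_osumD by blast
  next
    fix n x assume "x \<in> V" then show "finite {k\<in>K. fps_nth (G k) n x \<noteq> 0}"
      using sub fin by (meson finite_imageI finite_subset)
  qed
  show "S \<in> LC V" using F has_osumD by blast
  fix n x assume x: "x \<in> V"
  have "fps_nth S n x = (\<Sum>k\<in>\<pi> ` ?s n x. \<Sum>i\<in>{i\<in>?s n x. \<pi> i = k}. fps_nth (F i) n x)"
    using F x unfolding has_osum_def sum.image_gen[OF fin[OF x], symmetric] by simp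
  also have "\<dots> = (\<Sum>k\<in>\<pi> ` ?s n x. fps_nth (G k) n x)"
    using Gs \<pi> x by (intro sum.cong) auto
  finally show "\<exists>L. finite L \<and> L \<subseteq> K \<and> {k\<in>K. fps_nth (G k) n x \<noteq> 0} \<subseteq> L \<and>
      fps_nth S n x = (\<Sum>k\<in>L. fps_nth (G k) n x)"
    using sub[OF x] fin[OF x] \<pi> by (intro exI[of _ "\<pi> ` ?s n x"]) auto
qed

lemma has_osum_group_finite:
  assumes F: "has_osum F I S" and \<pi>: "\<And>i. i \<in> I \<Longrightarrow> \<pi> i \<in> K"
    and fin: "\<And>k. k \<in> K \<Longrightarrow> finite {i\<in>I. \<pi> i = k}"
  shows "has_osum (\<lambda>k. \<Sum>i\<in>{i\<in>I. \<pi> i = k}. F i) K S"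
  by (rule has_osum_group[OF F \<pi>])
    (use fin osummable_LC[OF has_osumD(1)[OF F]] in \<open>auto intro!: has_osum_finite\<close>)

lemma has_osum_reindex:
  assumes \<pi>: "bij_betw \<pi> I K" and G: "has_osum G K S"
  shows "has_osum (\<lambda>i. G (\<pi> i)) I S"
proof -
  have inj: "inj_on \<pi> I" and im: "\<pi> ` I = K" using \<pi> by (auto simp: bij_betw_def)
  have s: "{k\<in>K. fps_nth (G k) n x \<noteq> 0} = \<pi> ` {i\<in>I. fps_nth (G (\<pi> i)) n x \<noteq> 0}" for n x
    using im by auto
  have inj': "inj_on \<pi> {i\<in>I. fps_nth (G (\<pi> i)) n x \<noteq> 0}" for n x
    by (rule inj_on_subset[OF inj]) auto
  from G show ?thesis
    using im unfolding has_osum_def osummable_def s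
    by (auto simp: finite_image_iff[OF inj'] sum.reindex[OF inj'])
qed

lemma has_osum_extend:
  assumes F: "has_osum F I S" and "I \<subseteq> I'" "\<And>i. i \<in> I' - I \<Longrightarrow> F i = 0"
  shows "has_osum F I' S"
proof -
  have "{i\<in>I'. fps_nth (F i) n x \<noteq> 0} = {i\<in>I. fps_nth (F i) n x \<noteq> 0}" for n x
    using assms(2,3) by (force simp: op_nth)
  moreover have "F i \<in> LC V" if "i \<in> I'" for i
    using that assms by (cases "i \<in> I") (auto simp: has_osum_def osummable_def)
  ultimately show ?thesis using F by (simp add: has_osum_def osummable_def)
qed

lemma has_osum_scale:
  assumes F: "has_osum F I S" shows "has_osum (\<lambda>i. op_scale c (F i)) I (op_scale c S)"
proof -
  have "{i\<in>I. fps_nth (op_scale c (F i)) n x \<noteq> 0} \<subseteq> {i\<in>I. fps_nth (F i) n x \<noteq> 0}" for n x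
    by (auto simp: op_nth)
  note sub = this
  show ?thesis
  proof (rule has_osumI)
    show "osummable (\<lambda>i. op_scale c (F i)) I"
      using has_osumD(1)[OF F] finite_subset[OF sub] by (simp add: osummable_def)
    show "op_scale c S \<in> LC V" using has_osumD(2)[OF F] by simp
    fix n x assume x: "x \<in> V"
    let ?L = "{i\<in>I. fps_nth (F i) n x \<noteq> 0}"
    have "fps_nth (op_scale c S) n x = (\<Sum>i\<in>?L. fps_nth (op_scale c (F i)) n x)"
      using F x by (simp add: has_osum_def op_nth complex_vector.scale_sum_right)
    then show "\<exists>L. finite L \<and> L \<subseteq> I \<and> {i\<in>I. fps_nth (op_scale c (F i)) n x \<noteq> 0} \<subseteq> L \<and>
        fps_nth (op_scale c S) n x = (\<Sum>i\<in>L. fps_nth (op_scale c (F i)) n x)"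
      using sub x osummable_finite[OF has_osumD(1)[OF F] x] by (intro exI[of _ ?L]) auto
  qed
qed

lemma has_osum_add:
  assumes F: "has_osum F I S" and G: "has_osum G I R"
  shows "has_osum (\<lambda>i. F i + G i) I (S + R)"
proof -
  let ?L = "\<lambda>n x. {i\<in>I. fps_nth (F i) n x \<noteq> 0} \<union> {i\<in>I. fps_nth (G i) n x \<noteq> 0}"
  have sub: "{i\<in>I. fps_nth (F i + G i) n x \<noteq> 0} \<subseteq> ?L n x" for n x
    by (auto simp: op_nth)
  have fin: "finite (?L n x)" if "x \<in> V" for n x
    using that assms by (simp add: has_osumD osummable_finite)
  show ?thesis
  proof (rule has_osumI)
    show "osummable (\<lambda>i. F i + G i) I"
      using assms finite_subset[OF sub fin] by (simp add: osummable_def has_osum_def)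
    show "S + R \<in> LC V" using assms by (simp add: has_osumD)
    fix n x assume x: "x \<in> V"
    have "fps_nth S n x = (\<Sum>i\<in>?L n x. fps_nth (F i) n x)"
      by (rule has_osum_superset[OF F x fin[OF x]]) auto
    moreover have "fps_nth R n x = (\<Sum>i\<in>?L n x. fps_nth (G i) n x)"
      by (rule has_osum_superset[OF G x fin[OF x]]) auto
    ultimately have "fps_nth (S + R) n x = (\<Sum>i\<in>?L n x. fps_nth (F i + G i) n x)"
      by (simp add: op_nth sum.distrib)
    then show "\<exists>L. finite L \<and> L \<subseteq> I \<and> {i\<in>I. fps_nth (F i + G i) n x \<noteq> 0} \<subseteq> L \<and>
        fps_nth (S + R) n x = (\<Sum>i\<in>L. fps_nth (F i + G i) n x)"
      using sub fin[OF x] by (intro exI[of _ "?L n x"]) auto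
  qed
qed

lemma has_osum_mult:
  assumes F: "has_osum F I S" and G: "has_osum G K R"
  shows "has_osum (\<lambda>(i, k). F i \<odot> G k) (I \<times> K) (S \<odot> R)"
proof -
  \<comment> \<open>\<open>g n x\<close> holds the right indices visible at \<open>x\<close> up to
    order \<open>n\<close>, and \<open>f n x\<close> the left indices visible at the images of
    \<open>x\<close> under those. Their product is a finite set containing the support of the double
    family.\<close>
  define g where "g n x = (\<Union>m\<le>n. {k\<in>K. fps_nth (G k) m x \<noteq> 0})" for n x
  define f where "f n x = (\<Union>k\<in>g n x. \<Union>m\<le>n. \<Union>m'\<le>n. {i\<in>I. fps_nth (F i) m (fps_nth (G k) m' x) \<noteq> 0})" for n x
  note FL = osummable_LC[OF has_osumD(1)[OF F]] and GL = osummable_LC[OF has_osumD(1)[OF G]]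
  have SL: "S \<in> LC V" and RL: "R \<in> LC V" using F G by (simp_all add: has_osumD)
  have fing: "finite (g n x)" if "x \<in> V" for n x
    using that G by (simp add: g_def has_osumD osummable_finite)
  have gK: "g n x \<subseteq> K" for n x by (auto simp: g_def)
  have finf: "finite (f n x)" if "x \<in> V" for n x
    unfolding f_def using that F gK GL fing
    by (intro finite_UN_I fing finite_atMost) (auto simp: has_osumD osummable_finite LC_in_V subset_iff)
  have fI: "f n x \<subseteq> I" for n x by (auto simp: f_def)
  have sub: "{p\<in>I \<times> K. fps_nth (case p of (i, k) \<Rightarrow> F i \<odot> G k) n x \<noteq> 0} \<subseteq> f n x \<times> g n x" for n x
  proof clarify
    fix i k assume ik: "i \<in> I" "k \<in> K" "fps_nth (F i \<odot> G k) n x \<noteq> 0"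
    then obtain m where m: "m \<le> n" "fps_nth (F i) m (fps_nth (G k) (n - m) x) \<noteq> 0"
      unfolding op_mult_nth by (meson atMost_iff sum.neutral)
    then have "fps_nth (G k) (n - m) x \<noteq> 0" using FL ik by force
    then have "k \<in> g n x" using ik m by (auto simp: g_def intro!: bexI[of _ "n - m"])
    moreover from this have "i \<in> f n x" unfolding f_def using ik m
      by (intro UN_I[of k] UN_I[of m] UN_I[of "n - m"]) auto
    ultimately show "i \<in> f n x \<and> k \<in> g n x" by blast
  qed
  show ?thesis
  proof (rule has_osumI)
    show "osummable (\<lambda>(i, k). F i \<odot> G k) (I \<times> K)"
      unfolding osummable_def
      using FL GL finite_subset[OF sub finite_cartesian_product[OF finf fing]] by auto
    show "S \<odot> R \<in> LC V" using SL RL by simp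
    fix n x assume x: "x \<in> V"
    have "fps_nth (S \<odot> R) n x = (\<Sum>m\<le>n. fps_nth S m (\<Sum>k\<in>g n x. fps_nth (G k) (n - m) x))"
      unfolding op_mult_nth
    proof (rule sum.cong)
      fix m assume "m \<in> {..n}"
      then show "fps_nth S m (fps_nth R (n - m) x) = fps_nth S m (\<Sum>k\<in>g n x. fps_nth (G k) (n - m) x)"
        by (subst has_osum_superset[OF G x fing[OF x, of n] gK])
          (auto simp: g_def intro!: bexI[of _ "n - m"])
    qed simp
    also have "\<dots> = (\<Sum>m\<le>n. \<Sum>k\<in>g n x. fps_nth S m (fps_nth (G k) (n - m) x))"
      using SL gK GL by (intro sum.cong LC_sum) (auto simp: LC_in_V subset_iff)
    also have "\<dots> = (\<Sum>m\<le>n. \<Sum>k\<in>g n x. \<Sum>i\<in>f n x. fps_nth (F i) m (fps_nth (G k) (n - m) x))"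
    proof (intro sum.cong)
      fix m k assume mk: "m \<in> {..n}" "k \<in> g n x"
      have "fps_nth (G k) (n - m) x \<in> V" using mk gK GL by (auto simp: LC_in_V subset_iff)
      moreover have "{i\<in>I. fps_nth (F i) m (fps_nth (G k) (n - m) x) \<noteq> 0} \<subseteq> f n x"
      proof
        fix i assume "i \<in> {i\<in>I. fps_nth (F i) m (fps_nth (G k) (n - m) x) \<noteq> 0}"
        then show "i \<in> f n x" unfolding f_def
          using mk by (intro UN_I[of k] UN_I[of m] UN_I[of "n - m"]) auto
      qed
      ultimately show "fps_nth S m (fps_nth (G k) (n - m) x) = (\<Sum>i\<in>f n x. fps_nth (F i) m (fps_nth (G k) (n - m) x))"
        by (intro has_osum_superset[OF F] finf x fI)
    qed simp_all
    also have "\<dots> = (\<Sum>k\<in>g n x. \<Sum>i\<in>f n x. \<Sum>m\<le>n. fps_nth (F i) m (fps_nth (G k) (n - m) x))"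
      by (subst sum.swap, rule sum.cong, simp, rule sum.swap)
    also have "\<dots> = (\<Sum>i\<in>f n x. \<Sum>k\<in>g n x. fps_nth (F i \<odot> G k) n x)"
      by (subst sum.swap) (simp add: op_nth)
    also have "\<dots> = (\<Sum>p\<in>f n x \<times> g n x. fps_nth (case p of (i, k) \<Rightarrow> F i \<odot> G k) n x)"
      by (simp add: sum.cartesian_product case_prod_unfold)
    finally have "fps_nth (S \<odot> R) n x = \<dots>" .
    moreover have "finite (f n x \<times> g n x)" "f n x \<times> g n x \<subseteq> I \<times> K"
      using finf[OF x] fing[OF x] fI[of n x] gK[of n x] by auto
    ultimately show "\<exists>L. finite L \<and> L \<subseteq> I \<times> K \<and>
        {p\<in>I \<times> K. fps_nth (case p of (i, k) \<Rightarrow> F i \<odot> G k) n x \<noteq> 0} \<subseteq> L \<and>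
        fps_nth (S \<odot> R) n x = (\<Sum>p\<in>L. fps_nth (case p of (i, k) \<Rightarrow> F i \<odot> G k) n x)"
      using sub[of n x] by blast
  qed
qed

lemma has_osum_mult_left:
  assumes "A \<in> LC V" "has_osum F I S" shows "has_osum (\<lambda>i. A \<odot> F i) I (A \<odot> S)"
proof -
  have "has_osum (\<lambda>(i, k). A \<odot> F k) ({()} \<times> I) (A \<odot> S)"
    using has_osum_mult[OF has_osum_finite[of "{()}" "\<lambda>_. A"] assms(2)] assms(1) by simp
  from has_osum_reindex[OF _ this, of "\<lambda>i. ((), i)" I] show ?thesis
    by (auto simp: bij_betw_def inj_on_def)
qed

lemma has_osum_mult_right:
  assumes "A \<in> LC V" "has_osum F I S" shows "has_osum (\<lambda>i. F i \<odot> A) I (S \<odot> A)"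
proof -
  have "has_osum (\<lambda>(i, k). F i \<odot> A) (I \<times> {()}) (S \<odot> A)"
    using has_osum_mult[OF assms(2) has_osum_finite[of "{()}" "\<lambda>_. A"]] assms(1) by simp
  from has_osum_reindex[OF _ this, of "\<lambda>i. (i, ())" I] show ?thesis
    by (auto simp: bij_betw_def inj_on_def)
qed

section \<open>Adjoints of sums and products\<close>

lemma op_adjoint_has_osum:
  assumes F: "has_osum F I S" and G: "has_osum G I R"
    and adj: "\<And>i. i \<in> I \<Longrightarrow> op_adjoint V (F i) (G i)"
  shows "op_adjoint V S R"
  unfolding op_adjoint_def
proof (intro allI ballI)
  fix n x y assume xy: "x \<in> V" "y \<in> V"
  let ?L = "{i\<in>I. fps_nth (F i) n y \<noteq> 0} \<union> {i\<in>I. fps_nth (G i) n x \<noteq> 0}"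
  have fin: "finite ?L" using F G xy by (simp add: has_osumD osummable_finite)
  have "cinner x (fps_nth S n y) = cinner x (\<Sum>i\<in>?L. fps_nth (F i) n y)"
    by (subst has_osum_superset[OF F xy(2) fin]) auto
  also have "\<dots> = (\<Sum>i\<in>?L. cinner x (fps_nth (F i) n y))" by (rule cinner_sum_right)
  also have "\<dots> = (\<Sum>i\<in>?L. cinner (fps_nth (G i) n x) y)"
    using adj xy by (intro sum.cong) (auto simp: op_adjoint_def)
  also have "\<dots> = cinner (\<Sum>i\<in>?L. fps_nth (G i) n x) y" by (rule cinner_sum_left[symmetric])
  also have "\<dots> = cinner (fps_nth R n x) y"
    by (subst has_osum_superset[OF G xy(1) fin]) auto
  finally show "cinner x (fps_nth S n y) = cinner (fps_nth R n x) y" .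
qed

lemma op_adjoint_mult:
  assumes "A \<in> LC V" "A' \<in> LC V" "B \<in> LC V" "B' \<in> LC V" "op_adjoint V A A'" "op_adjoint V B B'"
  shows "op_adjoint V (A \<odot> B) (B' \<odot> A')"
  unfolding op_adjoint_def
proof (intro allI ballI)
  fix n x y assume xy: "x \<in> V" "y \<in> V"
  have "cinner x (fps_nth (A \<odot> B) n y) = (\<Sum>i\<le>n. cinner x (fps_nth A i (fps_nth B (n - i) y)))"
    by (simp add: op_nth cinner_sum_right)
  also have "\<dots> = (\<Sum>i\<le>n. cinner (fps_nth B' (n - i) (fps_nth A' i x)) y)"
    using assms xy by (simp add: op_adjoint_def LC_in_V)
  also have "\<dots> = (\<Sum>i\<le>n. cinner (fps_nth B' i (fps_nth A' (n - i) x)) y)"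
    by (rule sum.reindex_bij_witness[where i = "\<lambda>i. n - i" and j = "\<lambda>i. n - i"]) auto
  finally show "cinner x (fps_nth (A \<odot> B) n y) = cinner (fps_nth (B' \<odot> A') n x) y"
    by (simp add: op_nth cinner_sum_left)
qed

lemma op_adjoint_scale: "op_adjoint V A A' \<Longrightarrow> op_adjoint V (op_scale c A) (op_scale (cnj c) A')"
  by (simp add: op_adjoint_def op_nth cinner_scaleC_right cinner_scaleC_left)

lemma op_adjoint_one: "op_adjoint V (op_one V) (op_one V)"
  by (simp add: op_adjoint_def op_one_nth)

end


section \<open>Expansions over words\<close>

lemma tags_Nil [simp]: "{p. untag p = []} = {[]}"
  by (auto simp: untag_def)

lemma tags_Cons: "{p. untag p = x # w} =
    Cons (x, True) ` {p. untag p = w} \<union> Cons (x, False) ` {p. untag p = w}" (is "?L = ?R")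
proof -
  have "p \<in> ?L \<longleftrightarrow> p \<in> ?R" for p by (cases p) (auto simp: untag_def image_iff)
  then show ?thesis by blast
qed

lemma finite_tags [simp]: "finite {p. untag p = w}"
  by (induction w) (simp_all add: tags_Cons)

text \<open>The set \<open>{p. untag p = w}\<close> enumerates the unshufflings of \<open>w\<close>;
  the first letter joins either subword.\<close>

lemma sum_tags_Cons: "(\<Sum>p\<in>{p. untag p = x # w}. f p)
    = (\<Sum>p\<in>{p. untag p = w}. f ((x, True) # p) + f ((x, False) # p))"
  unfolding tags_Cons
  by (subst sum.union_disjoint) (auto simp: sum.reindex inj_on_def sum.distrib)

lemma tags_word1_Nil: "{p. untag p = w \<and> word1 p = []} = {map (\<lambda>x. (x, False)) w}"
proof -
  have "untag p = word2 p" if "word1 p = []" for p :: "('a \<times> bool) list"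
  proof -
    have "p \<in> tagged_shuffles [] (word2 p)" using that by (simp add: tagged_shuffles_def)
    then have "p = map (\<lambda>x. (x, False)) (word2 p)" by (simp add: tagged_shuffles_Nil1)
    then have "untag p = map fst (map (\<lambda>x. (x, False)) (word2 p))" by (metis untag_def)
    then show ?thesis by (simp add: comp_def)
  qed
  then have "{p. untag p = w \<and> word1 p = []} = tagged_shuffles [] w"
    by (auto simp: tagged_shuffles_def)
  then show ?thesis by (simp add: tagged_shuffles_Nil1)
qed

text \<open>Below, \<open>b x\<close> becomes a homogeneous component divided by
  \<open>\<i> * of_real hbar\<close>, so that brackets turn into plain commutators. Vanishing at
  order zero bounds the length of the words visible at each order.\<close>

locale word_ops = opalg V for V :: "'h::complex_inner set" +
  fixes \<Lambda> :: "complex set" and b :: "complex \<Rightarrow> 'h opfps"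
  assumes b_LC [simp]: "b x \<in> LC V"
    and b_order: "fps_nth (b x) 0 = 0"
    and b_summable: "osummable b \<Lambda>"
begin

section \<open>Products and nested commutators along words\<close>

primrec W :: "complex list \<Rightarrow> 'h opfps" where
  "W [] = op_one V"
| "W (x # w) = b x \<odot> W w"

primrec ad :: "complex list \<Rightarrow> 'h opfps \<Rightarrow> 'h opfps" where
  "ad [] A = A"
| "ad (x # w) A = b x \<odot> ad w A - ad w A \<odot> b x"

primrec dyn :: "complex list \<Rightarrow> 'h opfps" where
  "dyn [] = 0"
| "dyn (x # w) = (if w = [] then b x else b x \<odot> dyn w - dyn w \<odot> b x)"

lemma W_LC [simp]: "W w \<in> LC V" and ad_LC [simp]: "A \<in> LC V \<Longrightarrow> ad w A \<in> LC V"
  and dyn_LC [simp]: "dyn w \<in> LC V"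
  by (induction w) auto

lemma W_append: "W (u @ v) = W u \<odot> W v"
  by (induction u) (auto simp: op_mult_assoc)

lemma b_mult_order:
  assumes "A \<in> LC V" "\<And>m. m < p \<Longrightarrow> fps_nth A m = 0" "n < Suc p"
  shows "fps_nth (b x \<odot> A) n = 0" "fps_nth (A \<odot> b x) n = 0"
proof -
  have b: "fps_nth (b x) m = 0" if "m < 1" for m using that b_order by simp
  show "fps_nth (b x \<odot> A) n = 0"
    by (rule op_mult_order[of "b x" 1 p A]) (use assms b in auto)
  show "fps_nth (A \<odot> b x) n = 0"
    by (rule op_mult_order[of A p 1 "b x"]) (use assms b in auto)
qed

lemma W_order: "n < length w \<Longrightarrow> fps_nth (W w) n = 0"
proof (induction w arbitrary: n)
  case (Cons x w)
  have "n < Suc (length w)" using Cons.prems by simp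
  from b_mult_order(1)[OF W_LC Cons.IH this] show ?case by (simp only: W.simps)
qed simp

lemma ad_order: "A \<in> LC V \<Longrightarrow> n < length w \<Longrightarrow> fps_nth (ad w A) n = 0"
proof (induction w arbitrary: n)
  case (Cons x w)
  have "n < Suc (length w)" using Cons.prems by simp
  from b_mult_order[OF ad_LC Cons.IH this] Cons.prems(1) show ?case
    by (simp only: ad.simps fps_sub_nth diff_self)
qed simp

lemma dyn_order: "n < length w \<Longrightarrow> fps_nth (dyn w) n = 0"
proof (induction w arbitrary: n)
  case (Cons x w)
  have n: "n < Suc (length w)" using Cons.prems by simp
  from b_mult_order[OF dyn_LC Cons.IH this]
  have "fps_nth (b x \<odot> dyn w - dyn w \<odot> b x) n = 0"
    by (simp only: fps_sub_nth diff_self)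
  then show ?case using n b_order[of x] by (cases "w = []") (simp_all only: dyn.simps if_True if_False, simp)
qed simp

text \<open>A common criterion for \<open>W\<close>, \<open>ad\<close> and \<open>dyn\<close>.
  Within one length, a visible word extends a visible product of a letter with a shorter word, on
  the left or on the right; the last alternative in \<open>step\<close> serves \<open>dyn\<close>,
  whose value on one letter is not built from \<open>dyn []\<close>. At order \<open>n\<close> only
  lengths up to \<open>n\<close> count.\<close>

lemma osummable_words:
  assumes F: "\<And>w. F w \<in> LC V" "\<And>w n. n < length w \<Longrightarrow> fps_nth (F w) n = 0"
    and step: "\<And>x w n y. fps_nth (F (x # w)) n y \<noteq> 0 \<Longrightarrow>
      fps_nth (b x \<odot> F w) n y \<noteq> 0 \<or> fps_nth (F w \<odot> b x) n y \<noteq> 0 \<or> w = [] \<and> fps_nth (b x) n y \<noteq> 0"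
  shows "osummable F (lists \<Lambda>)"
proof -
  define L where "L r = {w\<in>lists \<Lambda>. length w = r}" for r
  have "osummable F (L r)" for r
  proof (induction r)
    case 0
    have "L 0 = {[]}" by (auto simp: L_def)
    then show ?case using F by (auto simp: osummable_def)
  next
    case (Suc r)
    have bF: "osummable (\<lambda>(x, w). b x \<odot> F w) (\<Lambda> \<times> L r)"
      using has_osum_mult[OF has_osum_op_sum[OF b_summable] has_osum_op_sum[OF Suc]] has_osumD by blast
    have Fb: "osummable (\<lambda>(w, x). F w \<odot> b x) (L r \<times> \<Lambda>)"
      using has_osum_mult[OF has_osum_op_sum[OF Suc] has_osum_op_sum[OF b_summable]] has_osumD by blast
    show ?case unfolding osummable_def
    proof (intro conjI ballI allI F)
      fix n y assume y: "y \<in> V"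
      let ?A = "{p\<in>\<Lambda> \<times> L r. fps_nth ((\<lambda>(x, w). b x \<odot> F w) p) n y \<noteq> 0}"
      let ?B = "{p\<in>L r \<times> \<Lambda>. fps_nth ((\<lambda>(w, x). F w \<odot> b x) p) n y \<noteq> 0}"
      let ?C = "{x\<in>\<Lambda>. fps_nth (b x) n y \<noteq> 0}"
      have "{w\<in>L (Suc r). fps_nth (F w) n y \<noteq> 0} \<subseteq>
          (\<lambda>(x, w). x # w) ` ?A \<union> (\<lambda>(w, x). x # w) ` ?B \<union> (\<lambda>x. [x]) ` ?C"
      proof
        fix w assume w: "w \<in> {w\<in>L (Suc r). fps_nth (F w) n y \<noteq> 0}"
        then obtain x v where xv: "w = x # v" "x \<in> \<Lambda>" "v \<in> L r" by (cases w) (auto simp: L_def)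
        from w step[of x v n y] xv consider "fps_nth (b x \<odot> F v) n y \<noteq> 0"
          | "fps_nth (F v \<odot> b x) n y \<noteq> 0" | "v = []" "fps_nth (b x) n y \<noteq> 0" by auto
        then show "w \<in> (\<lambda>(x, w). x # w) ` ?A \<union> (\<lambda>(w, x). x # w) ` ?B \<union> (\<lambda>x. [x]) ` ?C"
        proof cases
          case 1 then have "(x, v) \<in> ?A" using xv by simp
          then show ?thesis using xv by force
        next
          case 2 then have "(v, x) \<in> ?B" using xv by simp
          then show ?thesis using xv by force
        qed (use xv in auto)
      qed
      moreover have "finite ?A" "finite ?B" "finite ?C"
        using osummable_finite[OF bF y] osummable_finite[OF Fb y] osummable_finite[OF b_summable y] by blast+
      ultimately show "finite {w\<in>L (Suc r). fps_nth (F w) n y \<noteq> 0}"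
        by (meson finite_Un finite_imageI finite_subset)
    qed
  qed
  then have fin: "finite {w\<in>L r. fps_nth (F w) n y \<noteq> 0}" if "y \<in> V" for r n y
    using that by (simp add: osummable_def)
  show ?thesis unfolding osummable_def
  proof (intro conjI ballI allI F)
    fix n y assume y: "y \<in> V"
    have "{w\<in>lists \<Lambda>. fps_nth (F w) n y \<noteq> 0} \<subseteq> (\<Union>r\<le>n. {w\<in>L r. fps_nth (F w) n y \<noteq> 0})"
    proof
      fix w assume w: "w \<in> {w\<in>lists \<Lambda>. fps_nth (F w) n y \<noteq> 0}"
      then have "\<not> n < length w" using F(2)[of n w] by (auto simp: zero_fun_def)
      then show "w \<in> (\<Union>r\<le>n. {w\<in>L r. fps_nth (F w) n y \<noteq> 0})" using w by (auto simp: L_def)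
    qed
    then show "finite {w\<in>lists \<Lambda>. fps_nth (F w) n y \<noteq> 0}"
      using fin[OF y] by (meson finite_UN_I finite_atMost finite_subset)
  qed
qed

lemma osummable_scale: "osummable F I \<Longrightarrow> osummable (\<lambda>i. op_scale (c i) (F i)) I"
  by (rule osummable_pull[where \<pi> = "\<lambda>i. i" and K = I]) auto

lemma osummable_W: "osummable W (lists \<Lambda>)"
  by (rule osummable_words) (simp_all add: W_order)

lemma osummable_ad: "A \<in> LC V \<Longrightarrow> osummable (\<lambda>w. ad w A) (lists \<Lambda>)"
  by (rule osummable_words) (auto simp: ad_order op_diff_nth)

lemma osummable_dyn: "osummable dyn (lists \<Lambda>)"
  by (rule osummable_words) (auto simp: dyn_order op_diff_nth split: if_splits)

section \<open>Substitution of operators for letters\<close>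

definition Op :: "(complex list \<Rightarrow> complex) \<Rightarrow> 'h opfps" where
  "Op M = op_sum V (\<lambda>w. op_scale (M w) (W w)) (lists \<Lambda>)"

lemma has_osum_Op: "has_osum (\<lambda>w. op_scale (M w) (W w)) (lists \<Lambda>) (Op M)"
  unfolding Op_def by (intro has_osum_op_sum osummable_scale osummable_W)

lemma Op_LC [simp]: "Op M \<in> LC V"
  using has_osum_Op has_osumD by blast

lemma Op_eqI: "has_osum (\<lambda>w. op_scale (M w) (W w)) (lists \<Lambda>) S \<Longrightarrow> Op M = S"
  using has_osum_unique has_osum_Op by blast

lemma Op_add: "Op (\<lambda>w. M w + M' w) = Op M + Op M'"
  using has_osum_add[OF has_osum_Op has_osum_Op, of M M']
  by (intro Op_eqI) (simp add: op_scale_distribs)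

lemma Op_scale: "Op (\<lambda>w. c * M w) = op_scale c (Op M)"
  using has_osum_scale[OF has_osum_Op, of c M] by (intro Op_eqI) simp

lemma Op_munit: "Op munit = op_one V"
proof (rule Op_eqI)
  have "has_osum (\<lambda>w. op_scale (munit w) (W w)) {[]} (op_one V)"
    using has_osum_finite[of "{[]}" "\<lambda>w. op_scale (munit w) (W w)"] by simp
  then show "has_osum (\<lambda>w. op_scale (munit w) (W w)) (lists \<Lambda>) (op_one V)"
    by (rule has_osum_extend) (auto simp: munit_def)
qed

lemma Op_mletter:
  assumes "has_osum b \<Lambda> \<beta>"
  shows "Op mletter = \<beta>"
proof (rule Op_eqI)
  have "has_osum (\<lambda>w. b (hd w)) {w\<in>lists \<Lambda>. length w = 1} \<beta>"
  proof (rule has_osum_reindex[OF _ assms])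
    show "bij_betw hd {w\<in>lists \<Lambda>. length w = 1} \<Lambda>"
      by (rule bij_betw_byWitness[where f' = "\<lambda>x. [x]"]) (auto simp: length_Suc_conv)
  qed
  also have "has_osum (\<lambda>w. b (hd w)) {w\<in>lists \<Lambda>. length w = 1} \<beta>
      \<longleftrightarrow> has_osum (\<lambda>w. op_scale (mletter w) (W w)) {w\<in>lists \<Lambda>. length w = 1} \<beta>"
    by (rule has_osum_cong) (auto simp: length_Suc_conv mletter_def)
  finally show "has_osum (\<lambda>w. op_scale (mletter w) (W w)) (lists \<Lambda>) \<beta>"
    by (rule has_osum_extend) (auto simp: mletter_def)
qed

text \<open>Regroup the double sum over pairs of words by their concatenation: the fibre over
  \<open>w\<close> is the set of its cuts, which is what convolution sums over.\<close>

lemma Op_mconv: "Op (M \<star> M') = Op M \<odot> Op M'"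
proof (rule Op_eqI)
  let ?F = "\<lambda>(u, v). op_scale (M u) (W u) \<odot> op_scale (M' v) (W v)"
  let ?fib = "\<lambda>w. {p\<in>lists \<Lambda> \<times> lists \<Lambda>. fst p @ snd p = w}"
  have fib: "?fib w = (\<lambda>i. (take i w, drop i w)) ` {..length w}" if "w \<in> lists \<Lambda>" for w
  proof (rule Set.set_eqI)
    fix p show "p \<in> ?fib w \<longleftrightarrow> p \<in> (\<lambda>i. (take i w, drop i w)) ` {..length w}"
    proof
      assume "p \<in> ?fib w"
      then show "p \<in> (\<lambda>i. (take i w, drop i w)) ` {..length w}"
        by (intro image_eqI[of _ _ "length (fst p)"]) auto
    next
      assume "p \<in> (\<lambda>i. (take i w, drop i w)) ` {..length w}"
      then show "p \<in> ?fib w" using that by (auto dest: in_set_takeD in_set_dropD)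
    qed
  qed
  have "has_osum (\<lambda>w. sum ?F (?fib w)) (lists \<Lambda>) (Op M \<odot> Op M')"
  proof (rule has_osum_group_finite[OF has_osum_mult[OF has_osum_Op has_osum_Op]])
    fix w assume "w \<in> lists \<Lambda>" then show "finite (?fib w)" by (simp only: fib) simp
  qed auto
  also have "has_osum (\<lambda>w. sum ?F (?fib w)) (lists \<Lambda>) (Op M \<odot> Op M') \<longleftrightarrow>
    has_osum (\<lambda>w. op_scale ((M \<star> M') w) (W w)) (lists \<Lambda>) (Op M \<odot> Op M')"
  proof (rule has_osum_cong)
    fix w assume w: "w \<in> lists \<Lambda>"
    have inj: "inj_on (\<lambda>i. (take i w, drop i w)) {..length w}"
      by (rule inj_onI) (metis atMost_iff length_take min.absorb2 prod.inject)
    have "sum ?F (?fib w) = (\<Sum>i\<le>length w. ?F (take i w, drop i w))"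
      unfolding fib[OF w] by (subst sum.reindex[OF inj]) simp
    also have "\<dots> = (\<Sum>i\<le>length w. op_scale (M (take i w) * M' (drop i w)) (W w))"
      by (intro sum.cong) (simp_all add: op_mult_scale_left op_mult_scale_right flip: W_append)
    finally show "sum ?F (?fib w) = op_scale ((M \<star> M') w) (W w)"
      by (simp add: mconv_def op_scale_sum_left)
  qed
  finally show "has_osum (\<lambda>w. op_scale ((M \<star> M') w) (W w)) (lists \<Lambda>) (Op M \<odot> Op M')" .
qed

text \<open>Each letter moving past \<open>A\<close> either acts on it by commutator, with tag
  \<open>True\<close>, or passes to its right, with tag \<open>False\<close>.\<close>

lemma W_mult_Leibniz:
  assumes A: "A \<in> LC V"
  shows "W w \<odot> A = (\<Sum>p\<in>{p. untag p = w}. ad (word1 p) A \<odot> W (word2 p))"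
proof (induction w)
  case Nil
  show ?case using A by simp
next
  case (Cons x w)
  have "W (x # w) \<odot> A = b x \<odot> (\<Sum>p\<in>{p. untag p = w}. ad (word1 p) A \<odot> W (word2 p))"
    using A by (simp add: op_mult_assoc Cons)
  also have "\<dots> = (\<Sum>p\<in>{p. untag p = w}. b x \<odot> (ad (word1 p) A \<odot> W (word2 p)))"
    using A by (simp add: op_mult_sum_right)
  also have "\<dots> = (\<Sum>p\<in>{p. untag p = x # w}. ad (word1 p) A \<odot> W (word2 p))"
    unfolding sum_tags_Cons
    using A by (intro sum.cong) (simp_all add: op_mult_diff_left op_mult_assoc)
  finally show ?case .
qed

text \<open>Convolving the right-nested bracketing with the identity multiplies a word by its length; on
  primitive elements this is the Dynkin--Specht--Wever theorem.\<close>

lemma dyn_convolution: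
  "op_scale (of_nat (length w)) (W w) = (\<Sum>p\<in>{p. untag p = w}. dyn (word1 p) \<odot> W (word2 p))"
proof (induction w)
  case Nil
  show ?case by simp
next
  case (Cons x w)
  let ?P = "{p. untag p = w}"
  \<comment> \<open>For empty \<open>a\<close> the commutator vanishes since
    \<open>dyn [] = 0\<close>, so one formula covers both cases.\<close>
  have dyn: "dyn (x # a) = b x \<odot> dyn a - dyn a \<odot> b x + (if a = [] then b x else 0)" for a
    by simp
  have "(\<Sum>p\<in>{p. untag p = x # w}. dyn (word1 p) \<odot> W (word2 p))
      = (\<Sum>p\<in>?P. b x \<odot> (dyn (word1 p) \<odot> W (word2 p)) + (if word1 p = [] then W (x # w) else 0))"
    unfolding sum_tags_Cons
  proof (rule sum.cong)
    fix p assume p: "p \<in> ?P"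
    have "word2 p = w" if "word1 p = []"
    proof -
      have "p \<in> {p. untag p = w \<and> word1 p = []}" using p that by simp
      then have "p = map (\<lambda>x. (x, False)) w" unfolding tags_word1_Nil by simp
      then have "p \<in> tagged_shuffles [] w" by (simp add: tagged_shuffles_Nil1)
      then show ?thesis by (simp add: tagged_shuffles_def)
    qed
    then show "dyn (word1 ((x, True) # p)) \<odot> W (word2 ((x, True) # p))
        + dyn (word1 ((x, False) # p)) \<odot> W (word2 ((x, False) # p))
        = b x \<odot> (dyn (word1 p) \<odot> W (word2 p)) + (if word1 p = [] then W (x # w) else 0)"
      by (simp add: op_mult_diff_left op_mult_assoc)
  qed simp
  also have "\<dots> = b x \<odot> (\<Sum>p\<in>?P. dyn (word1 p) \<odot> W (word2 p))
      + (\<Sum>p\<in>?P. if word1 p = [] then W (x # w) else 0)"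
    by (simp add: sum.distrib op_mult_sum_right)
  \<comment> \<open>Exactly one splitting has an empty first subword; it raises the factor from the
    length of \<open>w\<close> to that of \<open>x # w\<close>.\<close>
  also have "(\<Sum>p\<in>?P. if word1 p = [] then W (x # w) else 0)
      = (\<Sum>p\<in>{p. untag p = w \<and> word1 p = []}. W (x # w))"
    by (subst sum.inter_filter[symmetric]) auto
  also have "\<dots> = W (x # w)" by (simp add: tags_word1_Nil)
  also have "b x \<odot> (\<Sum>p\<in>?P. dyn (word1 p) \<odot> W (word2 p)) = op_scale (of_nat (length w)) (W (x # w))"
    by (simp flip: Cons add: op_mult_scale_right)
  finally show ?case by (simp add: op_scale_distribs add.commute)
qed

text \<open>Duality of shuffling and unshuffling: one family over tagged words is grouped by the
  underlying word on one side and by the pair of subwords on the other. All fibres are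
  finite.\<close>

lemma has_osum_shuffle:
  assumes f: "osummable (\<lambda>(u, v). f u v) (lists \<Lambda> \<times> lists \<Lambda>)"
    and l: "has_osum (\<lambda>w. op_scale (M w) (\<Sum>p\<in>{p. untag p = w}. f (word1 p) (word2 p))) (lists \<Lambda>) S"
  shows "has_osum (\<lambda>(u, v). op_scale (shuffle_sum M u v) (f u v)) (lists \<Lambda> \<times> lists \<Lambda>) S"
proof -
  let ?I = "{p. untag p \<in> lists \<Lambda>}"
  let ?g = "\<lambda>p. op_scale (M (untag p)) (f (word1 p) (word2 p))"
  have wN: "word1 p \<in> lists \<Lambda>" "word2 p \<in> lists \<Lambda>" if "p \<in> ?I" for p
    using that set_word12[of p] by (auto simp: untag_def)
  have fib: "{p\<in>?I. (word1 p, word2 p) = (u, v)} = tagged_shuffles u v"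
    if "u \<in> lists \<Lambda>" "v \<in> lists \<Lambda>" for u v
  proof -
    have "untag p \<in> lists \<Lambda>" if "p \<in> tagged_shuffles u v" for p
    proof -
      have "set (untag p) = set u \<union> set v"
        using that set_word12[of p] by (simp add: tagged_shuffles_def untag_def)
      then show ?thesis using \<open>u \<in> lists \<Lambda>\<close> \<open>v \<in> lists \<Lambda>\<close> by auto
    qed
    then show ?thesis by (auto simp: tagged_shuffles_def)
  qed
  have "osummable ?g ?I"
  proof (rule osummable_pull[OF f, where \<pi> = "\<lambda>p. (word1 p, word2 p)"])
    fix k assume "k \<in> lists \<Lambda> \<times> lists \<Lambda>"
    then show "finite {p\<in>?I. (word1 p, word2 p) = k}" by (cases k) (simp only: fib mem_Times_iff fst_conv snd_conv finite_tagged_shuffles)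
  qed (use wN in auto)
  then have S: "has_osum ?g ?I (op_sum V ?g ?I)" by (rule has_osum_op_sum)
  have "has_osum (\<lambda>w. sum ?g {p\<in>?I. untag p = w}) (lists \<Lambda>) (op_sum V ?g ?I)"
    by (rule has_osum_group_finite[OF S]) (auto intro: finite_subset[OF _ finite_tags])
  also have "has_osum (\<lambda>w. sum ?g {p\<in>?I. untag p = w}) (lists \<Lambda>) (op_sum V ?g ?I) \<longleftrightarrow>
    has_osum (\<lambda>w. op_scale (M w) (\<Sum>p\<in>{p. untag p = w}. f (word1 p) (word2 p))) (lists \<Lambda>) (op_sum V ?g ?I)"
  proof (rule has_osum_cong)
    fix w assume "w \<in> lists \<Lambda>"
    then have "{p\<in>?I. untag p = w} = {p. untag p = w}" by auto
    then show "sum ?g {p\<in>?I. untag p = w} = op_scale (M w) (\<Sum>p\<in>{p. untag p = w}. f (word1 p) (word2 p))"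
      by (simp add: op_scale_sum)
  qed
  finally have "S = op_sum V ?g ?I" using l has_osum_unique by blast
  moreover have "has_osum (\<lambda>k. sum ?g {p\<in>?I. (word1 p, word2 p) = k}) (lists \<Lambda> \<times> lists \<Lambda>) (op_sum V ?g ?I)"
  proof (rule has_osum_group_finite[OF S])
    fix k assume "k \<in> lists \<Lambda> \<times> lists \<Lambda>"
    then show "finite {p\<in>?I. (word1 p, word2 p) = k}" by (cases k) (simp only: fib mem_Times_iff fst_conv snd_conv finite_tagged_shuffles)
  qed (use wN in auto)
  moreover have "has_osum (\<lambda>k. sum ?g {p\<in>?I. (word1 p, word2 p) = k}) (lists \<Lambda> \<times> lists \<Lambda>) (op_sum V ?g ?I) \<longleftrightarrow>
    has_osum (\<lambda>(u, v). op_scale (shuffle_sum M u v) (f u v)) (lists \<Lambda> \<times> lists \<Lambda>) (op_sum V ?g ?I)"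
  proof (rule has_osum_cong)
    fix k assume k: "k \<in> lists \<Lambda> \<times> lists \<Lambda>"
    obtain u v where uv: "k = (u, v)" by (cases k)
    have "sum ?g {p\<in>?I. (word1 p, word2 p) = k} = sum ?g (tagged_shuffles u v)"
      using k unfolding uv by (subst fib) auto
    also have "\<dots> = (\<Sum>p\<in>tagged_shuffles u v. op_scale (M (untag p)) (f u v))"
      by (intro sum.cong) (auto simp: tagged_shuffles_def)
    finally show "sum ?g {p\<in>?I. (word1 p, word2 p) = k} = (case k of (u, v) \<Rightarrow> op_scale (shuffle_sum M u v) (f u v))"
      by (simp add: uv shuffle_sum_def op_scale_sum_left)
  qed
  ultimately show ?thesis by simp
qed

text \<open>View the sum as one over pairs \<open>(u, [])\<close> and extend it to all pairs:
  alternality kills those with both words nonempty, \<open>dyn [] = 0\<close> the rest. Unshuffling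
  then turns it into \<open>dyn_convolution\<close>, which supplies the length.\<close>

lemma Op_F_coef: "has_osum (\<lambda>w. op_scale (N_coef w) (dyn w)) (lists \<Lambda>) (Op F_coef)"
proof -
  define X where "X = op_sum V (\<lambda>w. op_scale (N_coef w) (dyn w)) (lists \<Lambda>)"
  have X: "has_osum (\<lambda>w. op_scale (N_coef w) (dyn w)) (lists \<Lambda>) X"
    unfolding X_def by (intro has_osum_op_sum osummable_scale osummable_dyn)
  let ?D = "lists \<Lambda> \<times> {[] :: complex list}"
  have "has_osum (\<lambda>p. op_scale (N_coef (fst p)) (dyn (fst p))) ?D X"
    by (rule has_osum_reindex[OF _ X]) (auto simp: bij_betw_def inj_on_def)
  also have "has_osum (\<lambda>p. op_scale (N_coef (fst p)) (dyn (fst p))) ?D X \<longleftrightarrow>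
     has_osum (\<lambda>(u, v). op_scale (shuffle_sum N_coef u v) (dyn u \<odot> W v)) ?D X"
    by (rule has_osum_cong) auto
  finally have "has_osum (\<lambda>(u, v). op_scale (shuffle_sum N_coef u v) (dyn u \<odot> W v)) (lists \<Lambda> \<times> lists \<Lambda>) X"
  proof (rule has_osum_extend)
    fix p assume "p \<in> lists \<Lambda> \<times> lists \<Lambda> - ?D"
    then show "(case p of (u, v) \<Rightarrow> op_scale (shuffle_sum N_coef u v) (dyn u \<odot> W v)) = 0"
      by (cases p; cases "fst p = []") (auto simp: N_coef_alternal)
  qed auto
  moreover have "has_osum (\<lambda>(u, v). op_scale (shuffle_sum N_coef u v) (dyn u \<odot> W v)) (lists \<Lambda> \<times> lists \<Lambda>) (Op F_coef)"
  proof (rule has_osum_shuffle)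
    show "osummable (\<lambda>(u, v). dyn u \<odot> W v) (lists \<Lambda> \<times> lists \<Lambda>)"
      using has_osum_mult[OF has_osum_op_sum[OF osummable_dyn] has_osum_op_sum[OF osummable_W]] has_osumD by blast
    show "has_osum (\<lambda>w. op_scale (N_coef w) (\<Sum>p\<in>{p. untag p = w}. dyn (word1 p) \<odot> W (word2 p))) (lists \<Lambda>) (Op F_coef)"
      using has_osum_Op[of F_coef] by (simp add: F_coef_def mult.commute flip: dyn_convolution)
  qed
  ultimately show ?thesis using X has_osum_unique by blast
qed

lemma Op_S_inverse: "Op S_coef \<odot> Op (mantipode S_coef) = op_one V"
  "Op (mantipode S_coef) \<odot> Op S_coef = op_one V"
  by (simp_all add: S_coef_antipode_right S_coef_antipode_left Op_munit flip: Op_mconv)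

text \<open>Multiply the sum \<open>X\<close> of nested commutators by \<open>Op S_coef\<close> on
  the right. Symmetrality rewrites the product of coefficients as a shuffle sum, and
  \<open>W_mult_Leibniz\<close> resums it to \<open>Op S_coef \<odot> A\<close>; the inverse then
  isolates \<open>X\<close>.\<close>

lemma Op_S_conjugation:
  assumes A: "A \<in> LC V"
  shows "has_osum (\<lambda>w. op_scale (S_coef w) (ad w A)) (lists \<Lambda>) (Op S_coef \<odot> A \<odot> Op (mantipode S_coef))"
proof -
  define X where "X = op_sum V (\<lambda>w. op_scale (S_coef w) (ad w A)) (lists \<Lambda>)"
  have X: "has_osum (\<lambda>w. op_scale (S_coef w) (ad w A)) (lists \<Lambda>) X"
    unfolding X_def by (intro has_osum_op_sum osummable_scale osummable_ad A)
  have "has_osum (\<lambda>(u, v). op_scale (S_coef u) (ad u A) \<odot> op_scale (S_coef v) (W v)) (lists \<Lambda> \<times> lists \<Lambda>) (X \<odot> Op S_coef)"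
    by (rule has_osum_mult[OF X has_osum_Op])
  also have "(\<lambda>(u, v). op_scale (S_coef u) (ad u A) \<odot> op_scale (S_coef v) (W v))
      = (\<lambda>(u, v). op_scale (shuffle_sum S_coef u v) (ad u A \<odot> W v))"
    using A by (simp add: fun_eq_iff S_coef_symmetral op_mult_scale_left op_mult_scale_right)
  finally have "has_osum (\<lambda>(u, v). op_scale (shuffle_sum S_coef u v) (ad u A \<odot> W v)) (lists \<Lambda> \<times> lists \<Lambda>) (X \<odot> Op S_coef)" .
  moreover have "has_osum (\<lambda>(u, v). op_scale (shuffle_sum S_coef u v) (ad u A \<odot> W v)) (lists \<Lambda> \<times> lists \<Lambda>) (Op S_coef \<odot> A)"
  proof (rule has_osum_shuffle)
    show "osummable (\<lambda>(u, v). ad u A \<odot> W v) (lists \<Lambda> \<times> lists \<Lambda>)"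
      using has_osum_mult[OF has_osum_op_sum[OF osummable_ad[OF A]] has_osum_op_sum[OF osummable_W]] has_osumD by blast
    show "has_osum (\<lambda>w. op_scale (S_coef w) (\<Sum>p\<in>{p. untag p = w}. ad (word1 p) A \<odot> W (word2 p))) (lists \<Lambda>) (Op S_coef \<odot> A)"
      using has_osum_mult_right[OF A has_osum_Op[of S_coef]]
      by (simp add: op_mult_scale_left flip: W_mult_Leibniz[OF A])
  qed
  ultimately have "X \<odot> Op S_coef = Op S_coef \<odot> A" by (rule has_osum_unique)
  moreover have "X \<odot> Op S_coef \<odot> Op (mantipode S_coef) = X"
    using has_osumD(2)[OF X] by (simp add: op_mult_assoc Op_S_inverse)
  ultimately show ?thesis using X by simp
qed

text \<open>Commutation with \<open>K\<close> is a derivation, so each word of letters is an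
  eigenvector whose eigenvalue is \<open>c\<close> times the sum of its letters.\<close>

lemma Op_commutation:
  assumes K: "K \<in> LC V" and comm: "\<And>x. x \<in> \<Lambda> \<Longrightarrow> K \<odot> b x = b x \<odot> K + op_scale (c * x) (b x)"
  shows "K \<odot> Op M = Op M \<odot> K + op_scale c (Op (\<lambda>w. sum_list w * M w))"
proof -
  have W: "K \<odot> W w = W w \<odot> K + op_scale (c * sum_list w) (W w)" if "w \<in> lists \<Lambda>" for w
    using that
  proof (induction w)
    case Nil then show ?case using K by simp
  next
    case (Cons x w)
    have "K \<odot> W (x # w) = K \<odot> b x \<odot> W w"
      using K by (simp add: op_mult_assoc)
    also have "\<dots> = b x \<odot> (K \<odot> W w) + op_scale (c * x) (W (x # w))"
      using K Cons.hyps by (simp add: comm op_mult_add_left op_mult_scale_left op_mult_assoc)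
    also have "K \<odot> W w = W w \<odot> K + op_scale (c * sum_list w) (W w)" by (rule Cons.IH)
    finally show ?case
      using K by (simp add: op_mult_add_right op_mult_scale_right op_mult_assoc op_scale_distribs
        distrib_left add_ac)
  qed
  have "has_osum (\<lambda>w. op_scale (M w) (W w) \<odot> K + op_scale c (op_scale (sum_list w * M w) (W w))) (lists \<Lambda>)
      (Op M \<odot> K + op_scale c (Op (\<lambda>w. sum_list w * M w)))"
    by (intro has_osum_add has_osum_mult_right has_osum_scale has_osum_Op K)
  also have "has_osum (\<lambda>w. op_scale (M w) (W w) \<odot> K + op_scale c (op_scale (sum_list w * M w) (W w))) (lists \<Lambda>)
      (Op M \<odot> K + op_scale c (Op (\<lambda>w. sum_list w * M w))) \<longleftrightarrow>
    has_osum (\<lambda>w. K \<odot> op_scale (M w) (W w)) (lists \<Lambda>) (Op M \<odot> K + op_scale c (Op (\<lambda>w. sum_list w * M w)))"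
  proof (rule has_osum_cong)
    fix w assume "w \<in> lists \<Lambda>"
    then show "op_scale (M w) (W w) \<odot> K + op_scale c (op_scale (sum_list w * M w) (W w)) = K \<odot> op_scale (M w) (W w)"
      using K by (simp add: op_mult_scale_left op_mult_scale_right W op_scale_distribs mult_ac)
  qed
  finally show ?thesis using has_osum_mult_left[OF K has_osum_Op[of M]] has_osum_unique by blast
qed

lemma Op_normal_form:
  assumes K: "K \<in> LC V" and comm: "\<And>x. x \<in> \<Lambda> \<Longrightarrow> K \<odot> b x = b x \<odot> K + op_scale (c * x) (b x)"
    and \<beta>: "has_osum b \<Lambda> \<beta>"
  shows "Op S_coef \<odot> (K + op_scale c \<beta>) \<odot> Op (mantipode S_coef) = K + op_scale c (Op F_coef)"
    and "K \<odot> Op F_coef = Op F_coef \<odot> K"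
proof -
  let ?C = "Op S_coef" and ?F = "Op F_coef"
  have \<beta>L: "\<beta> \<in> LC V" using \<beta> has_osumD by blast
  \<comment> \<open>The scalar mould equation, about to be carried over to operators.\<close>
  have "(\<lambda>w. (F_coef \<star> S_coef) w + sum_list w * S_coef w) = S_coef \<star> mletter"
    by (simp add: fun_eq_iff F_S_coef)
  then have "?F \<odot> ?C + Op (\<lambda>w. sum_list w * S_coef w) = ?C \<odot> \<beta>"
    by (metis Op_add Op_mconv Op_mletter[OF \<beta>])
  then have *: "?C \<odot> op_scale c \<beta> = op_scale c (?F \<odot> ?C) + op_scale c (Op (\<lambda>w. sum_list w * S_coef w))"
    using \<beta>L by (simp add: op_mult_scale_right flip: op_scale_distribs)
  have "?C \<odot> (K + op_scale c \<beta>) = ?C \<odot> K + ?C \<odot> op_scale c \<beta>"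
    using K \<beta>L by (simp add: op_mult_add_right)
  also have "\<dots> = op_scale c (?F \<odot> ?C) + K \<odot> ?C"
    by (simp add: * Op_commutation[OF K comm, of S_coef] add_ac)
  also have "\<dots> = (K + op_scale c ?F) \<odot> ?C"
    using K by (simp add: op_mult_add_left op_mult_scale_left add.commute)
  finally show "?C \<odot> (K + op_scale c \<beta>) \<odot> Op (mantipode S_coef) = K + op_scale c ?F"
    using K by (simp add: op_mult_assoc Op_S_inverse)
  \<comment> \<open>\<open>F_coef\<close> lives on words with zero letter sum, where the eigenvalue
    of the commutator vanishes.\<close>
  have "Op (\<lambda>w. sum_list w * F_coef w) = 0"
    using Op_scale[of 0 munit] by (simp add: F_coef_resonant)
  then show "K \<odot> ?F = ?F \<odot> K"
    using Op_commutation[OF K comm, of F_coef] by simp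
qed

section \<open>Adjoints of substituted moulds and unitarity\<close>

lemma Op_adjoint:
  assumes adj: "\<And>x. x \<in> \<Lambda> \<Longrightarrow> cnj x \<in> \<Lambda> \<and> op_adjoint V (b x) (op_scale (-1) (b (cnj x)))"
  shows "op_adjoint V (Op M) (Op (mantipode (\<lambda>w. cnj (M (map cnj w)))))"
proof -
  let ?\<tau> = "\<lambda>w. rev (map cnj w)"
  let ?M = "mantipode (\<lambda>w. cnj (M (map cnj w)))"
  \<comment> \<open>The adjoint reverses the product, conjugates the letters and contributes one
    sign per letter: the antipode, up to conjugation.\<close>
  have W: "op_adjoint V (W w) (op_scale ((-1) ^ length w) (W (?\<tau> w)))" if "w \<in> lists \<Lambda>" for w
    using that
  proof (induction w)
    case Nil then show ?case by (simp add: op_adjoint_one)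
  next
    case (Cons x w)
    have "op_adjoint V (b x \<odot> W w) (op_scale ((-1) ^ length w) (W (?\<tau> w)) \<odot> op_scale (-1) (b (cnj x)))"
      using Cons adj[of x] by (intro op_adjoint_mult) auto
    then show ?case by (simp add: W_append op_mult_scale_left op_mult_scale_right)
  qed
  have "has_osum (\<lambda>w. op_scale (?M (?\<tau> w)) (W (?\<tau> w))) (lists \<Lambda>) (Op ?M)"
  proof (rule has_osum_reindex[OF _ has_osum_Op])
    show "bij_betw ?\<tau> (lists \<Lambda>) (lists \<Lambda>)"
      using adj by (intro bij_betw_byWitness[where f' = ?\<tau>]) (auto simp: rev_map comp_def)
  qed
  then show ?thesis
  proof (rule op_adjoint_has_osum[OF has_osum_Op])
    fix w assume "w \<in> lists \<Lambda>"
    from op_adjoint_scale[OF W[OF this], of "M w"]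
    show "op_adjoint V (op_scale (M w) (W w)) (op_scale (?M (?\<tau> w)) (W (?\<tau> w)))"
      by (simp add: mantipode_def rev_map comp_def mult.commute)
  qed
qed

text \<open>Since \<open>S_coef\<close> is invariant under conjugation of letters and values, the
  adjoint comes from its antipode, which is also the inverse.\<close>

lemma Op_S_unitary:
  assumes adj: "\<And>x. x \<in> \<Lambda> \<Longrightarrow> cnj x \<in> \<Lambda> \<and> op_adjoint V (b x) (op_scale (-1) (b (cnj x)))"
  shows "op_unitary V (Op S_coef)"
proof -
  have "op_adjoint V (Op S_coef) (Op (mantipode S_coef))"
    using Op_adjoint[OF adj, of S_coef] by (simp add: cnj_S_coef)
  then show ?thesis
    unfolding op_unitary_def using op_inverse_eqI[OF _ _ Op_S_inverse] by simp
qed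

lemma Op_F_skew:
  assumes adj: "\<And>x. x \<in> \<Lambda> \<Longrightarrow> cnj x \<in> \<Lambda> \<and> op_adjoint V (b x) (op_scale (-1) (b (cnj x)))"
  shows "op_adjoint V (Op F_coef) (op_scale (-1) (Op F_coef))"
proof -
  have "mantipode F_coef = (\<lambda>w. -1 * F_coef w)" by (simp add: fun_eq_iff mantipode_F_coef)
  then show ?thesis using Op_adjoint[OF adj, of F_coef] by (simp only: cnj_F_coef Op_scale)
qed

end


section \<open>Homogeneous components\<close>

locale band_ops =
  fixes hbar :: real and J :: "nat set" and e :: "nat \<Rightarrow> 'h::complex_inner" and E0 :: "nat \<Rightarrow> real"
    and B :: "'h opfps" and V :: "'h set"
  assumes hbar: "hbar > 0"
    and basis: "orthonormal_basis J e"
    and V_def: "V = cspan (e ` J)"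
    and B_real: "B \<in> LR V"
    and B_order: "fps_nth B 0 = 0"
begin

sublocale opalg V
  by unfold_locales (simp add: V_def complex_vector.subspace_span)

section \<open>Vectors and operators in the orthonormal basis\<close>

lemma e_in_V [simp]: "k \<in> J \<Longrightarrow> e k \<in> V"
  by (simp add: V_def complex_vector.span_base)

lemma orth: "k \<in> J \<Longrightarrow> l \<in> J \<Longrightarrow> cinner (e k) (e l) = (if k = l then 1 else 0)"
  using basis by (simp add: orthonormal_basis_def)

lemma e_nonzero: "k \<in> J \<Longrightarrow> e k \<noteq> 0"
  using orth[of k k] by auto

lemma V_induct [consumes 1, case_names subspace basis]:
  assumes "x \<in> V" "complex_vector.subspace {x. P x}" "\<And>k. k \<in> J \<Longrightarrow> P (e k)"
  shows "P x"
  using complex_vector.span_induct[of x "e ` J" P] assms by (auto simp: V_def)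

text \<open>The difference is orthogonal to the whole span, and in particular to itself.\<close>

lemma V_eqI:
  assumes xy: "x \<in> V" "y \<in> V" and eq: "\<And>l. l \<in> J \<Longrightarrow> cinner (e l) x = cinner (e l) y"
  shows "x = y"
proof -
  have "cinner w (x - y) = 0" if "w \<in> V" for w
    using that
  proof (induction rule: V_induct)
    case subspace show ?case
      by (auto simp: complex_vector.subspace_def cinner_add_left cinner_scaleC_left)
  next
    case (basis k)
    have "cinner (e k) x = cinner (e k) (x - y) + cinner (e k) y"
      by (simp flip: cinner_add_right)
    then show ?case using eq[OF basis] by simp
  qed
  then have "cinner (x - y) (x - y) = 0" using xy by simp
  then show ?thesis using norm_eq_sqrt_cinner[of "x - y"] by simp
qed

lemma LC_basis_eqI:
  assumes AC: "A \<in> LC V" "C \<in> LC V"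
    and eq: "\<And>n k l. k \<in> J \<Longrightarrow> l \<in> J \<Longrightarrow> cinner (e l) (fps_nth A n (e k)) = cinner (e l) (fps_nth C n (e k))"
  shows "A = C"
proof (rule LC_eqI[OF AC])
  fix n x assume "x \<in> V"
  \<comment> \<open>Membership in \<open>V\<close> is carried through the induction, as the
    coefficients are linear only there.\<close>
  then have "x \<in> V \<and> fps_nth A n x = fps_nth C n x"
  proof (induction rule: V_induct)
    case subspace show ?case
      using AC by (auto simp: complex_vector.subspace_def LC_add LC_scale)
  next
    case (basis k)
    then show ?case using AC eq by (auto intro!: V_eqI LC_in_V)
  qed
  then show "fps_nth A n x = fps_nth C n x" ..
qed

lemma op_adjoint_basisI:
  assumes AC: "A \<in> LC V" "C \<in> LC V"
    and eq: "\<And>n k l. k \<in> J \<Longrightarrow> l \<in> J \<Longrightarrow> cinner (e l) (fps_nth A n (e k)) = cinner (fps_nth C n (e l)) (e k)"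
  shows "op_adjoint V A C"
  unfolding op_adjoint_def
proof (intro allI ballI)
  fix n x y assume "x \<in> V" "y \<in> V"
  have "y \<in> V \<and> cinner (e l) (fps_nth A n y) = cinner (fps_nth C n (e l)) y" if "l \<in> J" for l
    using \<open>y \<in> V\<close>
  proof (induction rule: V_induct)
    case subspace show ?case
      using AC by (auto simp: complex_vector.subspace_def LC_add LC_scale cinner_add_right cinner_scaleC_right)
  next
    case (basis k)
    then show ?case using AC eq that by auto
  qed
  note l = this
  from \<open>x \<in> V\<close> have "x \<in> V \<and> cinner x (fps_nth A n y) = cinner (fps_nth C n x) y"
  proof (induction rule: V_induct)
    case subspace show ?case
      using AC by (auto simp: complex_vector.subspace_def LC_add LC_scale cinner_add_left cinner_scaleC_left)
  next
    case (basis k)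
    then show ?case using l by auto
  qed
  then show "cinner x (fps_nth A n y) = cinner (fps_nth C n x) y" ..
qed

lemma finite_support: "x \<in> V \<Longrightarrow> finite {k\<in>J. cinner (e k) x \<noteq> 0}"
proof (induction rule: V_induct)
  case subspace
  have "finite {k\<in>J. cinner (e k) (x + y) \<noteq> 0}"
    if "finite {k\<in>J. cinner (e k) x \<noteq> 0}" "finite {k\<in>J. cinner (e k) y \<noteq> 0}" for x y
    by (rule finite_subset[OF _ finite_UnI[OF that]]) (auto simp: cinner_add_right)
  moreover have "finite {k\<in>J. cinner (e k) (c *\<^sub>C x) \<noteq> 0}" if "finite {k\<in>J. cinner (e k) x \<noteq> 0}" for c x
    by (rule finite_subset[OF _ that]) (auto simp: cinner_scaleC_right)
  ultimately show ?case by (auto simp: complex_vector.subspace_def)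
next
  case (basis k)
  have "{l\<in>J. cinner (e l) (e k) \<noteq> 0} \<subseteq> {k}" using basis orth by (auto split: if_splits)
  then show ?case by (rule finite_subset) simp
qed

lemma op_summable_if_osummable: "osummable F I \<Longrightarrow> op_summable J e F I"
  by (auto simp: op_summable_def osummable_def)

lemma B_LC [simp]: "B \<in> LC V"
  using B_real by (auto simp: LR_def LC_def symops_def)

lemma B_sym: "x \<in> V \<Longrightarrow> y \<in> V \<Longrightarrow> cinner x (fps_nth B n y) = cinner (fps_nth B n x) y"
  using B_real by (auto simp: LR_def symops_def)

section \<open>Expansion of B into matrix entries\<close>

definition entry_op :: "nat \<times> nat \<Rightarrow> 'h opfps" where
  "entry_op p = Abs_fps (\<lambda>n. restrict_op V (\<lambda>x.
     fps_nth (matrix_coeff e B (fst p) (snd p)) n *\<^sub>C ketbra (e (snd p)) (e (fst p)) x))"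

lemma entry_op_nth: "x \<in> V \<Longrightarrow> fps_nth (entry_op (k, l)) n x
    = (cinner (e l) (fps_nth B n (e k)) * cinner (e k) x) *\<^sub>C e l"
  by (simp add: entry_op_def restrict_op_def matrix_coeff_def ketbra_def)

lemma entry_op_LC: "k \<in> J \<Longrightarrow> l \<in> J \<Longrightarrow> entry_op (k, l) \<in> LC V"
  by (subst LC_iff) (auto simp: entry_op_nth cinner_add_right cinner_scaleC_right distrib_left
    complex_vector.scale_left_distrib mult_ac entry_op_def restrict_op_def ketbra_def)

text \<open>A vector of the algebraic span meets finitely many columns \<open>k\<close>, and each
  column is finite because the coefficients of \<open>B\<close> preserve the span.\<close>

lemma osummable_entry_op:
  assumes "I \<subseteq> J \<times> J" shows "osummable entry_op I"
  unfolding osummable_def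
proof (intro conjI ballI allI)
  fix p assume "p \<in> I" then show "entry_op p \<in> LC V" using assms by (cases p) (auto simp: entry_op_LC)
next
  fix n x assume x: "x \<in> V"
  have "{p\<in>I. fps_nth (entry_op p) n x \<noteq> 0} \<subseteq>
      (SIGMA k:{k\<in>J. cinner (e k) x \<noteq> 0}. {l\<in>J. cinner (e l) (fps_nth B n (e k)) \<noteq> 0})"
    using assms x by (auto simp: entry_op_nth)
  moreover have "finite \<dots>"
    using x by (intro finite_SigmaI finite_support) (auto simp: LC_in_V)
  ultimately show "finite {p\<in>I. fps_nth (entry_op p) n x \<noteq> 0}" by (rule finite_subset)
qed

lemma matrix_sum_entry_op:
  assumes I: "I \<subseteq> J \<times> J" and S: "has_osum entry_op I S" and kl: "k \<in> J" "l \<in> J"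
  shows "cinner (e l) (fps_nth S n (e k)) = (if (k, l) \<in> I then cinner (e l) (fps_nth B n (e k)) else 0)"
proof -
  let ?K = "{p\<in>I. fps_nth (entry_op p) n (e k) \<noteq> 0}"
  have fin: "finite ?K" using osummable_finite[OF osummable_entry_op[OF I]] kl by simp
  have "cinner (e l) (fps_nth S n (e k)) = (\<Sum>p\<in>?K. cinner (e l) (fps_nth (entry_op p) n (e k)))"
    using S kl unfolding has_osum_def by (simp add: cinner_sum_right)
  also have "\<dots> = (\<Sum>p\<in>?K. if p = (k, l) then cinner (e l) (fps_nth B n (e k)) else 0)"
  proof (rule sum.cong)
    fix p assume "p \<in> ?K"
    then obtain k' l' where "p = (k', l')" "k' \<in> J" "l' \<in> J" using I by auto
    then show "cinner (e l) (fps_nth (entry_op p) n (e k)) = (if p = (k, l) then cinner (e l) (fps_nth B n (e k)) else 0)"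
      using kl by (auto simp: entry_op_nth cinner_scaleC_right orth)
  qed simp
  also have "\<dots> = (if (k, l) \<in> ?K then cinner (e l) (fps_nth B n (e k)) else 0)"
    using fin by (simp add: sum.delta)
  also have "\<dots> = (if (k, l) \<in> I then cinner (e l) (fps_nth B n (e k)) else 0)"
    using kl e_nonzero by (auto simp: entry_op_nth orth)
  finally show ?thesis .
qed

lemma has_osum_entry_op: "has_osum entry_op (J \<times> J) B"
proof -
  have S: "has_osum entry_op (J \<times> J) (op_sum V entry_op (J \<times> J))"
    by (intro has_osum_op_sum osummable_entry_op) simp
  have "op_sum V entry_op (J \<times> J) = B"
    using matrix_sum_entry_op[OF _ S] has_osumD(2)[OF S] by (intro LC_basis_eqI) auto
  then show ?thesis using S by simp
qed

section \<open>Homogeneous components of B\<close>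

abbreviation h :: complex where "h \<equiv> 1 / (\<i> * of_real hbar)"
abbreviation letters :: "complex set" where "letters \<equiv> eigen_alphabet hbar J E0"
abbreviation Bc :: "complex \<Rightarrow> 'h opfps" where "Bc \<equiv> hom_comp hbar J E0 e B"

definition b :: "complex \<Rightarrow> 'h opfps" where "b x = op_scale h (Bc x)"

definition hom_pairs :: "complex \<Rightarrow> (nat \<times> nat) set" where
  "hom_pairs lam = {(k, l). k \<in> J \<and> l \<in> J \<and> of_real (E0 l - E0 k) = \<i> * of_real hbar * lam}"

lemma hom_pairs_subset: "hom_pairs lam \<subseteq> J \<times> J"
  by (auto simp: hom_pairs_def)

text \<open>\<open>hom_comp\<close> sums entries that are not cut off outside \<open>V\<close>; as
  \<open>op_sum\<close> restricts to \<open>V\<close> anyway, the cut-off entries, which lie in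
  \<open>LC V\<close>, have the same sum.\<close>

lemma has_osum_hom_comp: "has_osum entry_op (hom_pairs lam) (Bc lam)"
proof -
  have "Bc lam = op_sum V entry_op (hom_pairs lam)"
    unfolding hom_comp_def op_sum_def V_def[symmetric] hom_pairs_def
    by (rule arg_cong[where f = Abs_fps])
      (auto simp: fun_eq_iff restrict_op_def entry_op_def case_prod_unfold intro!: sum.cong)
  then show ?thesis
    using has_osum_op_sum[OF osummable_entry_op[OF hom_pairs_subset]] by simp
qed

lemma Bc_LC [simp]: "Bc lam \<in> LC V"
  using has_osum_hom_comp has_osumD by blast

lemma matrix_hom_comp:
  assumes "k \<in> J" "l \<in> J"
  shows "cinner (e l) (fps_nth (Bc lam) n (e k)) =
    (if of_real (E0 l - E0 k) = \<i> * of_real hbar * lam then cinner (e l) (fps_nth B n (e k)) else 0)"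
  using matrix_sum_entry_op[OF hom_pairs_subset has_osum_hom_comp assms] assms
  by (simp add: hom_pairs_def)

lemma hom_comp_order: "fps_nth (Bc lam) 0 = 0"
proof
  fix x
  have "fps_nth (Bc lam) 0 x = 0" if "x \<in> V"
  proof (rule V_eqI)
    show "fps_nth (Bc lam) 0 x \<in> V" by (simp add: LC_in_V)
    fix l assume l: "l \<in> J"
    have "x \<in> V \<and> cinner (e l) (fps_nth (Bc lam) 0 x) = 0"
      using that
    proof (induction rule: V_induct)
      case subspace show ?case
        by (auto simp: complex_vector.subspace_def LC_add[OF Bc_LC] LC_scale[OF Bc_LC] LC_at_0[OF Bc_LC]
            cinner_add_right cinner_scaleC_right)
    next
      case (basis k)
      then show ?case using l by (simp add: matrix_hom_comp B_order)
    qed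
    then show "cinner (e l) (fps_nth (Bc lam) 0 x) = cinner (e l) 0" by simp
  qed simp
  then show "fps_nth (Bc lam) 0 x = 0 x" using LC_outside[OF Bc_LC] by auto
qed

text \<open>Group the entries of \<open>B\<close> by their eigenvalue; the fibre over
  \<open>lam\<close> is \<open>hom_pairs lam\<close>.\<close>

lemma has_osum_homogeneous: "has_osum Bc letters B"
proof (rule has_osum_group[OF has_osum_entry_op, where \<pi> = "\<lambda>(k, l). h * of_real (E0 l - E0 k)"])
  fix p assume "p \<in> J \<times> J"
  then show "(case p of (k, l) \<Rightarrow> h * of_real (E0 l - E0 k)) \<in> letters"
    by (auto simp: eigen_alphabet_def)
next
  fix lam
  have "{p\<in>J \<times> J. (case p of (k, l) \<Rightarrow> h * of_real (E0 l - E0 k)) = lam} = hom_pairs lam"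
    using hbar by (auto simp: hom_pairs_def field_simps)
  then show "has_osum entry_op {p\<in>J \<times> J. (case p of (k, l) \<Rightarrow> h * of_real (E0 l - E0 k)) = lam} (Bc lam)"
    using has_osum_hom_comp by simp
qed

lemma h_inverse: "\<i> * of_real hbar * h = 1"
  using hbar by simp

lemma has_osum_b: "has_osum b letters (op_scale h B)"
  using has_osum_scale[OF has_osum_homogeneous] by (simp add: b_def[abs_def])

sublocale word_ops V letters b
proof
  show "b x \<in> LC V" for x by (simp add: b_def)
  show "fps_nth (b x) 0 = 0" for x
    by (simp add: b_def op_scale_def hom_comp_order zero_fun_def)
  show "osummable b letters" using has_osum_b has_osumD by blast
qed

lemma cnj_alphabet:
  assumes "x \<in> letters" shows "cnj x \<in> letters"
proof -
  obtain k l where kl: "k \<in> J" "l \<in> J" "x = h * of_real (E0 l - E0 k)"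
    using assms by (auto simp: eigen_alphabet_def)
  then have "cnj x = h * of_real (E0 k - E0 l)" by (simp add: diff_divide_distrib)
  then show ?thesis using kl unfolding eigen_alphabet_def by blast
qed

text \<open>Exchanging \<open>k\<close> and \<open>l\<close> negates the energy difference, which
  for imaginary letters is conjugation, and symmetry of \<open>B\<close> matches the
  entries.\<close>

lemma hom_comp_adjoint: "op_adjoint V (Bc lam) (Bc (cnj lam))"
proof (rule op_adjoint_basisI)
  fix n k l assume kl: "k \<in> J" "l \<in> J"
  have iff: "of_real (E0 k - E0 l) = \<i> * of_real hbar * cnj lam \<longleftrightarrow>
      of_real (E0 l - E0 k) = \<i> * of_real hbar * lam"
    by (auto simp: complex_eq_iff)
  have "cinner (fps_nth (Bc (cnj lam)) n (e l)) (e k) = cnj (cinner (e k) (fps_nth (Bc (cnj lam)) n (e l)))"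
    by (rule cinner_commute)
  also have "\<dots> = cnj (if of_real (E0 l - E0 k) = \<i> * of_real hbar * lam then cinner (e k) (fps_nth B n (e l)) else 0)"
    by (simp only: matrix_hom_comp[OF kl(2,1)] iff)
  also have "\<dots> = cinner (e l) (fps_nth (Bc lam) n (e k))"
    using kl by (simp add: matrix_hom_comp B_sym flip: cinner_commute)
  finally show "cinner (e l) (fps_nth (Bc lam) n (e k)) = cinner (fps_nth (Bc (cnj lam)) n (e l)) (e k)" ..
qed simp_all

text \<open>The sign comes from \<open>h\<close> being imaginary.\<close>

lemma b_adjoint: "x \<in> letters \<Longrightarrow> cnj x \<in> letters \<and> op_adjoint V (b x) (op_scale (-1) (b (cnj x)))"
  using op_adjoint_scale[OF hom_comp_adjoint, of h x] by (simp add: b_def cnj_alphabet)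

section \<open>Brackets rewritten as commutators of the rescaled letters\<close>

lemma Bc_eq: "Bc x = op_scale (\<i> * of_real hbar) (b x)"
  by (simp add: b_def h_inverse del: times_divide_eq_right)

lemma op_bracket_b: "Y \<in> LC V \<Longrightarrow> op_bracket hbar (Bc x) Y = b x \<odot> Y - Y \<odot> b x"
  by (simp add: op_bracket_def op_commutator_def b_def op_scale_distribs op_mult_scale_left op_mult_scale_right)

lemma nested_ad_eq: "A \<in> LC V \<Longrightarrow> nested_ad hbar Bc w A = ad w A"
  by (induction w) (simp_all add: op_bracket_b)

text \<open>A nonempty word of length r has r - 1 brackets but r rescaled letters, which leaves one
  factor over.\<close>

lemma nested_bracket_eq: "nested_bracket hbar Bc w = op_scale (\<i> * of_real hbar) (dyn w)"
proof (induction w rule: induct_list012)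
  case (2 x)
  have "dyn [x] = b x" by simp
  then show ?case by (simp only: nested_bracket.simps Bc_eq)
next
  case (3 x y w)
  then show ?case by (simp add: op_bracket_b op_scale_distribs op_mult_scale_left op_mult_scale_right)
qed simp

lemma word_product_eq: "op_scale (h ^ length w) (word_product V Bc w) = W w"
proof (induction w)
  case (Cons x w)
  have "word_product V Bc w \<in> LC V" for w by (induction w) auto
  then have "op_scale (h ^ length (x # w)) (word_product V Bc (x # w))
      = op_scale h (Bc x) \<odot> op_scale (h ^ length w) (word_product V Bc w)"
    by (simp add: op_mult_scale_left op_mult_scale_right)
  then show ?case by (simp only: Cons W.simps flip: b_def)
qed simp

text \<open>On matrix entries, \<open>K\<close> multiplies by the energy of the row or of the
  column, and the nonzero entries of \<open>Bc x\<close> have the energy difference prescribed by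
  \<open>x\<close>.\<close>

lemma diagonal_op:
  assumes V_dom: "\<And>x y. x \<in> V \<Longrightarrow> y \<in> V \<Longrightarrow> H (x + y) = H x + H y"
    "\<And>c x. x \<in> V \<Longrightarrow> H (c *\<^sub>C x) = c *\<^sub>C H x"
    and H_e: "\<And>k. k \<in> J \<Longrightarrow> H (e k) = of_real (E0 k) *\<^sub>C e k"
  defines "K \<equiv> fps_const (restrict_op V H)"
  shows "K \<in> LC V" "K \<odot> b x = b x \<odot> K + op_scale (\<i> * of_real hbar * x) (b x)"
proof -
  have HV: "H x \<in> V \<and> (\<forall>l\<in>J. cinner (e l) (H x) = of_real (E0 l) * cinner (e l) x)" if "x \<in> V" for x
  proof -
    from that have "x \<in> V \<and> H x \<in> V \<and> (\<forall>l\<in>J. cinner (e l) (H x) = of_real (E0 l) * cinner (e l) x)"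
    proof (induction rule: V_induct)
      case subspace
      have "H 0 = 0" using V_dom(2)[of 0 0] by simp
      then show ?case
        by (auto simp: complex_vector.subspace_def V_dom cinner_add_right cinner_scaleC_right algebra_simps)
    next
      case (basis k)
      then show ?case by (auto simp: H_e cinner_scaleC_right orth)
    qed
    then show ?thesis by blast
  qed
  have K_nth: "fps_nth K n x = (if n = 0 then restrict_op V H x else 0)" for n x
    by (simp add: K_def zero_fun_def)
  show K: "K \<in> LC V"
    by (subst LC_iff) (simp add: K_nth restrict_op_def V_dom HV)
  have KA: "fps_nth (K \<odot> A) n x = H (fps_nth A n x)" if "A \<in> LC V" for A n x
  proof -
    have "fps_nth (K \<odot> A) n x = (\<Sum>i\<le>n. if i = 0 then H (fps_nth A n x) else 0)"
      unfolding op_nth by (rule sum.cong) (use that in \<open>auto simp: K_nth restrict_op_def LC_in_V\<close>)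
    then show ?thesis by simp
  qed
  have AK: "fps_nth (A \<odot> K) n x = fps_nth A n (H x)" if "A \<in> LC V" "x \<in> V" for A n x
  proof -
    have "fps_nth (A \<odot> K) n x = (\<Sum>i\<le>n. if i = n then fps_nth A n (H x) else 0)"
      unfolding op_nth by (rule sum.cong) (use that in \<open>auto simp: K_nth restrict_op_def\<close>)
    then show ?thesis by simp
  qed
  have "K \<odot> Bc x = Bc x \<odot> K + op_scale (\<i> * of_real hbar * x) (Bc x)"
  proof (rule LC_basis_eqI)
    fix n k l assume kl: "k \<in> J" "l \<in> J"
    have "cinner (e l) (fps_nth (Bc x \<odot> K + op_scale (\<i> * of_real hbar * x) (Bc x)) n (e k))
      = (of_real (E0 k) + \<i> * of_real hbar * x) * cinner (e l) (fps_nth (Bc x) n (e k))"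
      using kl by (simp add: op_add_nth op_scale_nth AK H_e LC_scale[OF Bc_LC] cinner_add_right
          cinner_scaleC_right distrib_right)
    also have "\<dots> = of_real (E0 l) * cinner (e l) (fps_nth (Bc x) n (e k))"
      unfolding matrix_hom_comp[OF kl] by (auto simp: algebra_simps)
    also have "\<dots> = cinner (e l) (fps_nth (K \<odot> Bc x) n (e k))"
      using kl by (simp add: KA HV LC_in_V)
    finally show "cinner (e l) (fps_nth (K \<odot> Bc x) n (e k))
      = cinner (e l) (fps_nth (Bc x \<odot> K + op_scale (\<i> * of_real hbar * x) (Bc x)) n (e k))" ..
  qed (use K in simp_all)
  then have "op_scale h (K \<odot> Bc x) = op_scale h (Bc x \<odot> K + op_scale (\<i> * of_real hbar * x) (Bc x))"
    by simp
  then show "K \<odot> b x = b x \<odot> K + op_scale (\<i> * of_real hbar * x) (b x)"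
    using K by (simp add: b_def op_mult_scale_left op_mult_scale_right op_scale_distribs mult_ac)
qed

end

section \<open>Assembly of the normal form\<close>

theorem theorem4:
  fixes hbar :: real
    and J :: "nat set"
    and e :: "nat \<Rightarrow> 'h::complex_hilbert"
    and E0 :: "nat \<Rightarrow> real"
    and D0 :: "'h set" and H0 :: "'h \<Rightarrow> 'h"
    and B :: "'h opfps"
    and Um Up :: mould
    and V :: "'h set"
    and \<N> :: "complex set"
    and H0' N C :: "'h opfps"
    and Ncoef Scoef :: "complex list \<Rightarrow> complex"
    and B_comp :: "complex \<Rightarrow> 'h opfps"
    and \<Psi> :: "'h opfps \<Rightarrow> 'h opfps"
  assumes hbar: "hbar > 0"
    and separable: "\<exists>Q::'h set. countable Q \<and> closure Q = UNIV"
    and basis: "orthonormal_basis J e"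
    and selfadj: "self_adjoint D0 H0"
    and diag: "\<And>k. k \<in> J \<Longrightarrow> e k \<in> D0 \<and> H0 (e k) = complex_of_real (E0 k) *\<^sub>C e k"
    and V_def: "V = cspan (e ` J)"
    and H0'_def: "H0' = fps_const (restrict_op V H0)"
    and B_real: "B \<in> LR V"
    and B_order: "fps_nth B 0 = 0"
    and B_band: "finite_band J e B"
    and alphabet_def: "\<N> = eigen_alphabet hbar J E0"
    and B_comp_def: "B_comp = hom_comp hbar J E0 e B"
    and birkhoff: "birkhoff_decomposition \<N> T_mould Um Up"
    and Ncoef_def: "\<And>w. Ncoef w = - fls_residue (Um w)"
    and Scoef_def: "\<And>w. Scoef w = fls_nth (Up w) 0"
    and N_def: "N = op_sum V (\<lambda>w. op_scale (Ncoef w) (nested_bracket hbar B_comp w)) (lists \<N>)"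
    and Psi_def: "\<And>A. \<Psi> A = op_sum V (\<lambda>w. op_scale (Scoef w) (nested_ad hbar B_comp w A)) (lists \<N>)"
    and C_def: "C = op_sum V (\<lambda>w. op_scale ((1 / (\<i> * of_real hbar)) ^ length w * Scoef w)
                                   (word_product V B_comp w)) (lists \<N>)"
  shows "op_summable J e (\<lambda>w. op_scale (Ncoef w) (nested_bracket hbar B_comp w)) (lists \<N>)
    \<and> N \<in> LR V
    \<and> (\<forall>A\<in>LC V. op_summable J e (\<lambda>w. op_scale (Scoef w) (nested_ad hbar B_comp w A)) (lists \<N>))
    \<and> unitary_conjugation V \<Psi>
    \<and> \<Psi> (H0' + B) = H0' + N
    \<and> op_commutator H0' N = 0
    \<and> op_summable J e (\<lambda>w. op_scale ((1 / (\<i> * of_real hbar)) ^ length w * Scoef w)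
                              (word_product V B_comp w)) (lists \<N>)
    \<and> op_unitary V C
    \<and> (\<forall>A\<in>LC V. \<Psi> A = C \<odot> A \<odot> op_inverse V C)"
proof -
  have D0: "complex_vector.subspace D0" and H_add: "\<And>x y. x \<in> D0 \<Longrightarrow> y \<in> D0 \<Longrightarrow> H0 (x + y) = H0 x + H0 y"
    and H_scale: "\<And>c x. x \<in> D0 \<Longrightarrow> H0 (c *\<^sub>C x) = c *\<^sub>C H0 x"
    using selfadj by (auto simp: self_adjoint_def)
  \<comment> \<open>The span lies in the domain of \<open>H0\<close>, so that linearity there
    carries over to \<open>V\<close>.\<close>
  have V_D0: "V \<subseteq> D0"
    unfolding V_def using D0 diag by (intro complex_vector.span_minimal) auto
  interpret band_ops hbar J e E0 B V
    using hbar basis V_def B_real B_order by unfold_locales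
  have K: "H0' \<in> LC V" and comm: "\<And>x. H0' \<odot> b x = b x \<odot> H0' + op_scale (\<i> * of_real hbar * x) (b x)"
    using diagonal_op[of H0] V_D0 diag H_add H_scale by (auto simp: H0'_def subset_iff)
  \<comment> \<open>Uniqueness of the Birkhoff decomposition on the alphabet identifies the given
    factors with \<open>U_minus\<close> and \<open>U_plus\<close>.\<close>
  have coef: "Ncoef w = N_coef w" "Scoef w = S_coef w" if "w \<in> lists \<N>" for w
    using birkhoff_decomposition_unique[OF T_mould_Nil birkhoff birkhoff_U that]
    by (simp_all add: Ncoef_def Scoef_def N_coef_def S_coef_def)
  let ?C = "Op S_coef" and ?C' = "Op (mantipode S_coef)"
  let ?N = "op_scale (\<i> * of_real hbar) (Op F_coef)"

  have sum_N: "has_osum (\<lambda>w. op_scale (Ncoef w) (nested_bracket hbar B_comp w)) (lists \<N>) ?N"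
    using has_osum_scale[OF Op_F_coef, of "\<i> * of_real hbar"] unfolding alphabet_def
    by (rule has_osum_cong[THEN iffD1, rotated])
      (simp add: coef[unfolded alphabet_def] B_comp_def nested_bracket_eq mult.commute)
  have sum_Psi: "has_osum (\<lambda>w. op_scale (Scoef w) (nested_ad hbar B_comp w A)) (lists \<N>) (?C \<odot> A \<odot> ?C')"
    if A: "A \<in> LC V" for A
    using Op_S_conjugation[OF A] unfolding alphabet_def
    by (rule has_osum_cong[THEN iffD1, rotated])
      (simp add: coef[unfolded alphabet_def] B_comp_def nested_ad_eq[OF A])
  have sum_C: "has_osum (\<lambda>w. op_scale ((1 / (\<i> * of_real hbar)) ^ length w * Scoef w)
      (word_product V B_comp w)) (lists \<N>) ?C"
    using has_osum_Op[of S_coef] unfolding alphabet_def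
    by (rule has_osum_cong[THEN iffD1, rotated])
      (simp add: coef[unfolded alphabet_def] B_comp_def mult.commute flip: word_product_eq)
  have N: "N = ?N" unfolding N_def by (rule op_sum_eqI[OF sum_N])
  have C: "C = ?C" unfolding C_def by (rule op_sum_eqI[OF sum_C])
  have inv: "op_inverse V ?C = ?C'"
    by (rule op_inverse_eqI(2)[OF _ _ Op_S_inverse]) simp_all
  have Psi: "\<Psi> A = C \<odot> A \<odot> op_inverse V C" if "A \<in> LC V" for A
    unfolding Psi_def C inv by (rule op_sum_eqI[OF sum_Psi[OF that]])
  have unitary: "op_unitary V C"
    unfolding C by (rule Op_S_unitary[OF b_adjoint])

  \<comment> \<open>\<open>Op F_coef\<close> is skew, and the imaginary factor in front makes it
    symmetric.\<close>
  have adj_N: "op_adjoint V N N"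
    using op_adjoint_scale[OF Op_F_skew[OF b_adjoint], of "\<i> * of_real hbar"] by (simp add: N)
  moreover have "N \<in> LC V" by (simp add: N)
  ultimately have N_LR: "N \<in> LR V"
    by (simp add: LR_def LC_def symops_def op_adjoint_def)

  \<comment> \<open>Brings \<open>B\<close> into the form \<open>op_scale c \<beta>\<close> of
    \<open>Op_normal_form\<close>, with \<open>\<beta>\<close> the sum of the rescaled
    letters.\<close>
  have B: "B = op_scale (\<i> * of_real hbar) (op_scale (1 / (\<i> * of_real hbar)) B)"
    using hbar by simp
  have "\<Psi> (H0' + B) = ?C \<odot> (H0' + B) \<odot> ?C'"
    using K by (simp add: Psi C inv)
  also have "\<dots> = H0' + N"
    unfolding N by (subst B) (rule Op_normal_form(1)[OF K comm has_osum_b])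
  finally have normal: "\<Psi> (H0' + B) = H0' + N" .
  have "op_commutator H0' N = 0"
    using K Op_normal_form(2)[OF K comm has_osum_b]
    by (simp add: op_commutator_def N op_mult_scale_left op_mult_scale_right)
  then show ?thesis
    using N_LR normal unitary Psi op_summable_if_osummable has_osumD(1)[OF sum_N]
      has_osumD(1)[OF sum_C] has_osumD(1)[OF sum_Psi]
    by (auto simp: unitary_conjugation_def)
qed

end
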